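(* Let $\{X_t: t\ge0\}$ be an irreducible continuous-time Markov process on a countable state space $E$ which admits a stationary measure $\mu$. If the Markov process $\{X^s_t:t\ge0\}$ is recurrent and $$\sum_{(x,y)\in\mathcal E}\frac{c_a(x,y)^2}{c_s(x,y)}<\infty,$$ then $\{X_t:t\ge0\}$ is recurrent.
   Context: $X_t$ has jump rates $r(x,y)$ ($x\ne y$) and holding rates $\lambda(x)=\sum_y r(x,y)$, with paths in the space of right-continuous functions with left limits $D(\mathbb R_+,E)$. The stationary measure $\mu$ (not necessarily finite, $\mu(x)>0$) satisfies $\sum_y\mu(y)r(y,x)=\mu(x)\lambda(x)$. For $x\ne y$ put $c(x,y)=\mu(x)r(x,y)$, $c_s(x,y)=\frac12\{c(x,y)+c(y,x)\}$, $c_a(x,y)=\frac12\{c(x,y)-c(y,x)\}$, and $\mathcal E=\{(x,y)\in E\times E:x\ne y,\ c_s(x,y)>0\}$. $X^s_t$, the symmetric (reversible) version of $X_t$, is the Markov process with jump rates $c_s(x,y)/\mu(x)$; equivalently its generator is $S=\frac12(L+L^* )$, where $L$ is the generator of $X_t$ and $L^*$ that of its adjoint with respect to $\mu$. *)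

theory Defs
  imports "HOL-Probability.Probability"
begin

text \<open>
  The state space is a countable type with the discrete topology. A jump-rate function \<open>r\<close> is
  only meaningful off the diagonal; the values \<open>r x x\<close> are never used. Time is \<open>real\<close>, restricted
  to \<open>t \<ge> 0\<close>.
\<close>

definition holding_rate :: "('e \<Rightarrow> 'e \<Rightarrow> real) \<Rightarrow> 'e \<Rightarrow> real" where
  "holding_rate r x = (\<Sum>\<^sub>\<infinity>y\<in>-{x}. r x y)"

text \<open>
  The space \<open>D(\<real>\<^sub>+, E)\<close>. Left limits are required to exist in \<open>E\<close>
  itself, so there are finitely many jumps in bounded time: the process does not explode.
\<close>

definition cadlag :: "(real \<Rightarrow> 'e) \<Rightarrow> bool" where
  "cadlag p \<longleftrightarrow>
     (\<forall>t\<ge>0. limitin (discrete_topology UNIV) p (p t) (at_right t)) \<and>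
     (\<forall>t>0. \<exists>l. limitin (discrete_topology UNIV) p l (at_left t))"

definition natural_filtration :: "'w measure \<Rightarrow> (real \<Rightarrow> 'w \<Rightarrow> 'e) \<Rightarrow> real \<Rightarrow> 'w measure" where
  "natural_filtration M X t =
     sigma (space M) {X u -` A \<inter> space M | u A. 0 \<le> u \<and> u \<le> t}"

definition trans_prob :: "('e \<Rightarrow> 'w measure) \<Rightarrow> (real \<Rightarrow> 'w \<Rightarrow> 'e) \<Rightarrow> real \<Rightarrow> 'e \<Rightarrow> 'e \<Rightarrow> real" where
  "trans_prob P X t x y = measure (P x) {w \<in> space (P x). X t w = y}"

text \<open>
  A time-homogeneous Markov process with jump rates \<open>r\<close>: \<open>P x\<close> is the law of the process started
  at \<open>x\<close>. The jump rates are the derivatives at time 0 of the transition probabilities; the last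
  assumption says that the total rate of leaving \<open>x\<close> is the (finite) sum of the rates \<open>r x y\<close>.
\<close>

locale markov_jump_process =
  fixes P :: "'e::countable \<Rightarrow> 'w measure"
    and X :: "real \<Rightarrow> 'w \<Rightarrow> 'e"
    and r :: "'e \<Rightarrow> 'e \<Rightarrow> real"
  assumes prob_space_P: "prob_space (P x)"
    and sets_P: "sets (P x) = sets (P y)"
    and measurable_X: "0 \<le> t \<Longrightarrow> X t \<in> measurable (P x) (count_space UNIV)"
    and cadlag_X: "w \<in> space (P x) \<Longrightarrow> cadlag (\<lambda>t. X t w)"
    and start: "AE w in P x. X 0 w = x"
    and markov: "\<lbrakk>0 \<le> s; 0 \<le> t\<rbrakk> \<Longrightarrow>
          AE w in P x.
            real_cond_exp (P x) (natural_filtration (P x) X s)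
              (indicator {v \<in> space (P x). X (s + t) v = z}) w
            = trans_prob P X t (X s w) z"
    and rate_nonneg: "x \<noteq> y \<Longrightarrow> 0 \<le> r x y"
    and rate_summable: "(\<lambda>y. r x y) summable_on (-{x})"
    and jump_rate: "x \<noteq> y \<Longrightarrow>
          ((\<lambda>h. trans_prob P X h x y / h) \<longlongrightarrow> r x y) (at_right 0)"
    and leave_rate:
          "((\<lambda>h. (1 - trans_prob P X h x x) / h) \<longlongrightarrow> holding_rate r x) (at_right 0)"

definition irreducible_process :: "('e \<Rightarrow> 'w measure) \<Rightarrow> (real \<Rightarrow> 'w \<Rightarrow> 'e) \<Rightarrow> bool" where
  "irreducible_process P X \<longleftrightarrow> (\<forall>x y. \<exists>t\<ge>0. trans_prob P X t x y > 0)"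

text \<open>
  Started at any \<open>x\<close>, the set of times spent at \<open>x\<close> is almost surely unbounded.
  Unlike return after the first departure, this makes an absorbing state recurrent; the
  two notions agree at states with positive holding rate.
\<close>

definition recurrent_process :: "('e \<Rightarrow> 'w measure) \<Rightarrow> (real \<Rightarrow> 'w \<Rightarrow> 'e) \<Rightarrow> bool" where
  "recurrent_process P X \<longleftrightarrow> (\<forall>x. AE w in P x. \<forall>T\<ge>0. \<exists>t\<ge>T. X t w = x)"

text \<open>The measure is given by its point masses and may have infinite total mass.\<close>

definition stationary_measure :: "('e \<Rightarrow> 'e \<Rightarrow> real) \<Rightarrow> ('e \<Rightarrow> real) \<Rightarrow> bool" where
  "stationary_measure r \<mu> \<longleftrightarrow>
     (\<forall>x. \<mu> x > 0) \<and>
     (\<forall>x. ((\<lambda>y. \<mu> y * r y x) has_sum (\<mu> x * holding_rate r x)) (-{x}))"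

definition cond :: "('e \<Rightarrow> real) \<Rightarrow> ('e \<Rightarrow> 'e \<Rightarrow> real) \<Rightarrow> 'e \<Rightarrow> 'e \<Rightarrow> real" where
  "cond \<mu> r x y = \<mu> x * r x y"

definition cond_sym :: "('e \<Rightarrow> real) \<Rightarrow> ('e \<Rightarrow> 'e \<Rightarrow> real) \<Rightarrow> 'e \<Rightarrow> 'e \<Rightarrow> real" where
  "cond_sym \<mu> r x y = (cond \<mu> r x y + cond \<mu> r y x) / 2"

definition cond_asym :: "('e \<Rightarrow> real) \<Rightarrow> ('e \<Rightarrow> 'e \<Rightarrow> real) \<Rightarrow> 'e \<Rightarrow> 'e \<Rightarrow> real" where
  "cond_asym \<mu> r x y = (cond \<mu> r x y - cond \<mu> r y x) / 2"

definition edges :: "('e \<Rightarrow> real) \<Rightarrow> ('e \<Rightarrow> 'e \<Rightarrow> real) \<Rightarrow> ('e \<times> 'e) set" where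
  "edges \<mu> r = {(x, y). x \<noteq> y \<and> cond_sym \<mu> r x y > 0}"

definition sym_rate :: "('e \<Rightarrow> real) \<Rightarrow> ('e \<Rightarrow> 'e \<Rightarrow> real) \<Rightarrow> 'e \<Rightarrow> 'e \<Rightarrow> real" where
  "sym_rate \<mu> r x y = cond_sym \<mu> r x y / \<mu> x"

end

theory Submission
  imports Defs
begin

text \<open>
  Fix a state \<open>a\<close> and let \<open>u x\<close> be the probability that \<open>X\<close> started at \<open>x\<close> hits \<open>a\<close>. This function is
  superharmonic for the rates \<open>r\<close>, and \<open>X\<close> is recurrent if \<open>u = 1\<close> everywhere, for all \<open>a\<close>.

  Recurrence of the symmetric process gives finitely supported \<open>f\<close> with values in \<open>[0, 1]\<close>, with
  \<open>f b = 1\<close> at a prescribed state \<open>b\<close> and with arbitrarily small energy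
  \<open>\<Sum> c\<^sub>s(x,y) (f x - f y)\<^sup>2\<close>: take the equilibrium potentials of \<open>b\<close> in finite sets exhausting the
  state space. Testing the subharmonicity of \<open>v = 1 - u\<close> against \<open>f\<^sup>2 v\<close> gives a Caccioppoli
  inequality. Since \<open>\<Sum>\<^sub>y c\<^sub>a(x,y) = 0\<close>, its antisymmetric part can be written as
  \<open>\<Sum> c\<^sub>a(x,y) v(x) v(y) (f\<^sup>2 x - f\<^sup>2 y)\<close>, with the gradient on \<open>f\<close> only, so it is controlled by
  \<open>\<Sum> c\<^sub>a\<^sup>2 / c\<^sub>s\<close> and the energy of \<open>f\<close>. Letting the energy tend to 0, \<open>u\<close> takes equal values at
  the ends of every edge, so \<open>{u = 1}\<close> cannot be entered from outside, and irreducibility gives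
  \<open>u = 1\<close>.
\<close>

subsection \<open>Right-continuous paths with left limits in a discrete space\<close>

definition grid :: "nat \<Rightarrow> nat \<Rightarrow> real" where
  "grid k i = real i / 2 ^ k"

lemma grid_nonneg [simp]: "0 \<le> grid k i"
  by (simp add: grid_def)

lemma grid_0 [simp]: "grid k 0 = 0"
  by (simp add: grid_def)

lemma grid_Suc: "grid k (Suc i) = grid k i + 1 / 2 ^ k"
  by (simp add: grid_def add_divide_distrib)

lemma grid_mono: "i \<le> j \<Longrightarrow> grid k i \<le> grid k j"
  by (simp add: grid_def divide_right_mono)

lemma grid_refine: "k \<le> l \<Longrightarrow> grid k i = grid l (i * 2 ^ (l - k))"
  by (simp add: grid_def field_simps flip: power_add)

lemma filterlim_dyadic_at_right_0: "filterlim (\<lambda>k. 1 / 2 ^ k :: real) (at_right 0) sequentially"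
proof -
  have "(\<lambda>k. (1/2) ^ k :: real) \<longlonglongrightarrow> 0"
    by (rule LIMSEQ_power_zero) simp
  then show ?thesis
    by (auto simp: filterlim_at power_one_over)
qed

lemma limitin_discrete_eventually:
  "limitin (discrete_topology UNIV) p l F \<longleftrightarrow> (\<forall>\<^sub>F s in F. p s = l)"
proof
  assume "limitin (discrete_topology UNIV) p l F"
  then have "\<forall>\<^sub>F s in F. p s \<in> {l}"
    unfolding limitin_def openin_discrete_topology by blast
  then show "\<forall>\<^sub>F s in F. p s = l" by simp
next
  assume "\<forall>\<^sub>F s in F. p s = l"
  then show "limitin (discrete_topology UNIV) p l F"
    unfolding limitin_def by (auto elim: eventually_mono)
qed

lemma cadlag_right:
  assumes "cadlag p" "0 \<le> t"
  obtains d where "0 < d" "\<And>s. t \<le> s \<Longrightarrow> s < t + d \<Longrightarrow> p s = p t"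
proof -
  have "\<forall>\<^sub>F s in at_right t. p s = p t"
    using assms by (simp add: cadlag_def limitin_discrete_eventually)
  then obtain b where b: "b > t" "\<And>s. t < s \<Longrightarrow> s < b \<Longrightarrow> p s = p t"
    by (auto simp: eventually_at_right_field)
  show ?thesis
    by (rule that[of "b - t"]) (use b in \<open>force simp: less_eq_real_def\<close>)+
qed

lemma cadlag_left:
  assumes "cadlag p" "0 < t"
  obtains d l where "0 < d" "\<And>s. t - d < s \<Longrightarrow> s < t \<Longrightarrow> p s = l"
proof -
  obtain l where "\<forall>\<^sub>F s in at_left t. p s = l"
    using assms by (auto simp: cadlag_def limitin_discrete_eventually)
  then obtain b where b: "b < t" "\<And>s. b < s \<Longrightarrow> s < t \<Longrightarrow> p s = l"
    by (auto simp: eventually_at_left_field)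
  show ?thesis
    by (rule that[of "t - b" l]) (use b in auto)
qed

text \<open>Every time has a neighbourhood in which the path takes at most two values, one on each
  side; compactness of the interval, in the form of Bolzano bisection, gives finiteness. This is how
  absence of explosion enters the proof.\<close>

lemma cadlag_finite_range:
  assumes "cadlag p"
  shows "finite (p ` {0..T})"
proof (cases "0 \<le> T")
  case True
  \<comment> \<open>The intersection with \<open>{0..}\<close> is needed since the intervals tested
    by bisection around time 0 may reach negative times, where nothing is known about
    \<open>p\<close>.\<close>
  have "finite (p ` ({0..T} \<inter> {0..}))"
  proof (rule Bolzano[of 0 T "\<lambda>a b. finite (p ` ({a..b} \<inter> {0..}))"])
    fix a b c :: real
    assume "finite (p ` ({a..b} \<inter> {0..}))" "finite (p ` ({b..c} \<inter> {0..}))"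
    then have "finite (p ` ({a..b} \<inter> {0..}) \<union> p ` ({b..c} \<inter> {0..}))"
      by simp
    then show "finite (p ` ({a..c} \<inter> {0..}))"
      by (rule rev_finite_subset) force
  next
    fix t :: real
    assume t: "0 \<le> t"
    obtain d where d: "0 < d" "\<And>s. t \<le> s \<Longrightarrow> s < t + d \<Longrightarrow> p s = p t"
      using cadlag_right[OF assms t] by metis
    obtain d' l where d': "0 < d'" "\<And>s. 0 \<le> s \<Longrightarrow> t - d' < s \<Longrightarrow> s < t \<Longrightarrow> p s = l"
    proof (cases "t = 0")
      case True
      \<comment> \<open>At time 0 there is no earlier nonnegative time, so the left value is
        arbitrary.\<close>
      with that[of 1 undefined] show ?thesis by auto
    next
      case False
      with t have "0 < t" by simp
      from cadlag_left[OF assms this] that show ?thesis by metis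
    qed
    have "finite (p ` ({a..b} \<inter> {0..}))" if "a \<le> t" "t \<le> b" "b - a < min d d'" for a b
    proof (rule finite_subset)
      show "p ` ({a..b} \<inter> {0..}) \<subseteq> {p t, l}"
      proof (rule image_subsetI)
        fix s assume s: "s \<in> {a..b} \<inter> {0..}"
        show "p s \<in> {p t, l}"
        proof (cases "t \<le> s")
          case True then show ?thesis using d(2)[of s] s that by auto
        next
          case False then show ?thesis using d'(2)[of s] s that by auto
        qed
      qed
    qed simp
    then show "\<exists>e>0. \<forall>a b. a \<le> t \<and> t \<le> b \<and> b - a < e \<longrightarrow> finite (p ` ({a..b} \<inter> {0..}))"
      using d(1) d'(1) by (intro exI[of _ "min d d'"]) auto
  qed (use True in simp)
  moreover have "{0..T} \<inter> {0..} = {0..T}" by auto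
  ultimately show ?thesis by simp
qed simp

lemma cadlag_dyadic:
  assumes "cadlag p" "0 \<le> T" "T \<le> t"
  obtains k i where "p (T + grid k i) = p t" "t \<le> T + grid k i" "1 \<le> i"
proof -
  obtain d where d: "0 < d" "\<And>s. t \<le> s \<Longrightarrow> s < t + d \<Longrightarrow> p s = p t"
    using cadlag_right[OF assms(1), of t] assms by auto
  obtain k where k: "(1/2) ^ k < d"
    using real_arch_pow_inv[OF d(1), of "1/2"] by auto
  \<comment> \<open>The first point of the grid shifted by \<open>T\<close> that lies strictly after
    \<open>t\<close>. It is at distance at most \<open>1 / 2 ^ k < d\<close>, where the path still
    has its value at \<open>t\<close>.\<close>
  define i where "i = nat \<lfloor>(t - T) * 2 ^ k\<rfloor> + 1"
  have "0 \<le> (t - T) * 2 ^ k" using assms by simp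
  then have "(t - T) * 2 ^ k < real i" "real i \<le> (t - T) * 2 ^ k + 1"
    unfolding i_def by linarith+
  then have "t - T < grid k i" "grid k i \<le> (t - T) + 1 / 2 ^ k"
    by (simp_all add: grid_def field_simps)
  then have "t \<le> T + grid k i" "T + grid k i < t + d"
    using k by (simp_all add: power_one_over)
  moreover from this d(2) have "p (T + grid k i) = p t" by blast
  ultimately show ?thesis
    by (intro that[of k i]) (simp_all add: i_def)
qed

text \<open>The target \<open>a\<close> is put into every set, so that stopping at \<open>a\<close>
  makes sense from the first set on.\<close>

definition exhaustion :: "'e::countable \<Rightarrow> nat \<Rightarrow> 'e set" where
  "exhaustion a N = insert a {x. to_nat x \<le> N}"

lemma finite_exhaustion: "finite (exhaustion a N)"
  using finite_vimageI[of "{..N}" to_nat] by (auto simp: exhaustion_def vimage_def)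

lemma exhaustion_self: "a \<in> exhaustion a N"
  by (simp add: exhaustion_def)

lemma incseq_exhaustion: "incseq (exhaustion a)"
  by (auto simp: exhaustion_def incseq_def)

lemma eventually_in_exhaustion: "\<forall>\<^sub>F N in sequentially. x \<in> exhaustion a N"
  using eventually_ge_at_top[of "to_nat x"] by eventually_elim (simp add: exhaustion_def)

subsection \<open>Hitting probabilities\<close>

context markov_jump_process
begin

section \<open>Measurability of events of the process\<close>

lemma space_natural_filtration [simp]: "space (natural_filtration M X s) = space M"
  by (simp add: natural_filtration_def space_measure_of_conv)

lemma sets_natural_filtration:
  "sets (natural_filtration M X s) = sigma_sets (space M) {X u -` A \<inter> space M | u A. 0 \<le> u \<and> u \<le> s}"
  by (simp add: natural_filtration_def) (rule sets_measure_of, auto)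

lemma measurable_X_filtration:
  "0 \<le> u \<Longrightarrow> u \<le> s \<Longrightarrow> X u \<in> measurable (natural_filtration M X s) (count_space UNIV)"
  by (rule measurableI) (auto simp: sets_natural_filtration intro!: sigma_sets.Basic)

lemma subalgebra_filtration: "subalgebra (P x) (natural_filtration (P x) X s)"
proof -
  have "X u -` A \<inter> space (P x) \<in> sets (P x)" if "0 \<le> u" for u A
    using measurable_X[OF that, of x] by (rule measurable_sets) simp
  then have "sigma_sets (space (P x)) {X u -` A \<inter> space (P x) |u A. 0 \<le> u \<and> u \<le> s} \<subseteq> sets (P x)"
    by (intro sets.sigma_sets_subset) auto
  then show ?thesis
    by (simp add: subalgebra_def sets_natural_filtration)
qed

lemma filtration_event:
  "B \<in> sets (natural_filtration (P x) X s) \<Longrightarrow> B \<in> sets (P x)"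
  using subalgebra_filtration[of x s] by (auto simp: subalgebra_def)

lemma filtration_mono:
  assumes "s \<le> t" "B \<in> sets (natural_filtration M X s)"
  shows "B \<in> sets (natural_filtration M X t)"
proof -
  have "sigma_sets (space M) {X u -` A \<inter> space M |u A. 0 \<le> u \<and> u \<le> s}
      \<subseteq> sigma_sets (space M) {X u -` A \<inter> space M |u A. 0 \<le> u \<and> u \<le> t}"
    using assms(1) by (intro sigma_sets_mono') (blast intro: order_trans)
  with assms(2) show ?thesis by (auto simp: sets_natural_filtration)
qed

lemma state_event: "0 \<le> t \<Longrightarrow> {w \<in> space (P x). Q (X t w)} \<in> sets (P x)"
  using measurable_sets[OF measurable_X[of t x], of "Collect Q"] by (simp add: vimage_def Int_def conj_commute)

lemma state_event_filtration:
  "0 \<le> u \<Longrightarrow> u \<le> s \<Longrightarrow> {w \<in> space M. Q (X u w)} \<in> sets (natural_filtration M X s)"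
  using measurable_sets[OF measurable_X_filtration, of u s "Collect Q" M]
  by (simp add: vimage_def Int_def conj_commute)

lemma event_state_filtration:
  assumes "B \<in> sets (natural_filtration M X s)" "0 \<le> u" "u \<le> s"
  shows "{w \<in> B. Q (X u w)} \<in> sets (natural_filtration M X s)"
proof -
  have "{w \<in> B. Q (X u w)} = B \<inter> {w \<in> space M. Q (X u w)}"
    using sets.sets_into_space[OF assms(1)] by auto
  then show ?thesis using assms state_event_filtration[OF assms(2,3), of M Q] by auto
qed

lemma event_state:
  assumes "B \<in> sets (P x)" "0 \<le> u"
  shows "{w \<in> B. Q (X u w)} \<in> sets (P x)"
proof -
  have "{w \<in> B. Q (X u w)} = B \<inter> {w \<in> space (P x). Q (X u w)}"
    using sets.sets_into_space[OF assms(1)] by auto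
  then show ?thesis using assms state_event[OF assms(2), of x Q] by auto
qed

section \<open>The Markov property along a time grid\<close>

lemma markov_step:
  assumes "0 \<le> s" "0 \<le> t" and B: "B \<in> sets (natural_filtration (P x) X s)"
  shows "measure (P x) {w \<in> B. X s w = y \<and> X (s + t) w = z}
       = measure (P x) {w \<in> B. X s w = y} * trans_prob P X t y z"
proof -
  interpret prob_space "P x" by (rule prob_space_P)
  interpret F: finite_measure_subalgebra "P x" "natural_filtration (P x) X s"
    by unfold_locales (rule subalgebra_filtration)
  define A where "A = {w \<in> B. X s w = y}"
  define Z where "Z = {v \<in> space (P x). X (s + t) v = z}"
  have A: "A \<in> sets (natural_filtration (P x) X s)"
    unfolding A_def using B assms by (intro event_state_filtration) auto
  have AP: "A \<in> sets (P x)"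
    using A by (rule filtration_event)
  have Z: "Z \<in> sets (P x)"
    unfolding Z_def using assms by (intro state_event) simp
  have "measure (P x) (A \<inter> Z) = (\<integral>w\<in>A. indicator Z w \<partial>P x)"
    using AP Z by (simp add: set_lebesgue_integral_def flip: indicator_inter_arith)
  also have "\<dots> = (\<integral>w\<in>A. real_cond_exp (P x) (natural_filtration (P x) X s) (indicator Z) w \<partial>P x)"
    by (rule F.real_cond_exp_intA) (use Z A in \<open>auto intro!: integrable_real_indicator simp: emeasure_eq_measure\<close>)
  \<comment> \<open>On \<open>A\<close> the present state is \<open>y\<close>, so the conditional
    expectation is almost surely the constant \<open>trans_prob P X t y z\<close>.\<close>
  also have "\<dots> = (\<integral>w\<in>A. trans_prob P X t y z \<partial>P x)"
  proof (rule set_lebesgue_integral_cong_AE)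
    show "AE w in P x. w \<in> A \<longrightarrow>
        real_cond_exp (P x) (natural_filtration (P x) X s) (indicator Z) w = trans_prob P X t y z"
      using markov[OF assms(1,2), of x z] unfolding Z_def A_def by eventually_elim auto
  qed (use AP in auto)
  also have "\<dots> = measure (P x) A * trans_prob P X t y z"
    using AP by (simp add: set_lebesgue_integral_def)
  finally have "measure (P x) (A \<inter> Z) = measure (P x) A * trans_prob P X t y z" .
  moreover have "A \<inter> Z = {w \<in> B. X s w = y \<and> X (s + t) w = z}"
    using sets.sets_into_space[OF filtration_event[OF B]] by (auto simp: A_def Z_def)
  ultimately show ?thesis by (simp add: A_def)
qed

text \<open>The probability that the chain observed at multiples of \<open>d\<close> and started at
  \<open>y\<close> avoids \<open>a\<close> at steps 1 to \<open>m\<close>; step 0 is exempt, so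
  \<open>y = a\<close> is allowed. Being defined from the transition probabilities alone, it serves
  to compare different starting laws. Values in \<open>ennreal\<close> spare all summability
  questions.\<close>

primrec avoid_prob :: "real \<Rightarrow> 'e \<Rightarrow> nat \<Rightarrow> 'e \<Rightarrow> ennreal" where
  "avoid_prob d a 0 y = 1"
| "avoid_prob d a (Suc m) y =
     (\<integral>\<^sup>+z. ennreal (trans_prob P X d y z) * (if z = a then 0 else avoid_prob d a m z) \<partial>count_space UNIV)"

lemma avoid_event:
  assumes "B \<in> sets (P x)" "0 \<le> s" "0 \<le> d"
  shows "{w \<in> B. X s w = y \<and> (\<forall>i\<in>{1..m}. X (s + real i * d) w \<noteq> a)} \<in> sets (P x)"
proof -
  have "{w \<in> B. X s w = y \<and> (\<forall>i\<in>{1..m}. X (s + real i * d) w \<noteq> a)}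
     = {w \<in> B. X s w = y} \<inter> {w \<in> space (P x). \<forall>i\<in>{1..m}. X (s + real i * d) w \<noteq> a}"
    using sets.sets_into_space[OF assms(1)] by auto
  also have "\<dots> \<in> sets (P x)"
    using assms by (intro sets.Int event_state sets.sets_Collect_finite_All) (auto intro!: state_event)
  finally show ?thesis .
qed

text \<open>Induction on \<open>m\<close> with a first-step decomposition. The past event
  \<open>B\<close> is kept general because the induction hypothesis is applied at time
  \<open>s + d\<close> to \<open>B\<close> enlarged by the condition on the state at time
  \<open>s\<close>.\<close>

lemma emeasure_avoid:
  assumes "B \<in> sets (natural_filtration (P x) X s)" "0 \<le> s" "0 \<le> d"
  shows "emeasure (P x) {w \<in> B. X s w = y \<and> (\<forall>i\<in>{1..m}. X (s + real i * d) w \<noteq> a)}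
       = emeasure (P x) {w \<in> B. X s w = y} * avoid_prob d a m y"
  using assms
proof (induction m arbitrary: B s y)
  case (Suc m)
  interpret prob_space "P x" by (rule prob_space_P)
  define B' where "B' = {w \<in> B. X s w = y}"
  have B': "B' \<in> sets (natural_filtration (P x) X (s + d))"
    unfolding B'_def using Suc.prems
    by (intro filtration_mono[of s "s + d"] event_state_filtration) auto
  define C where "C z = {w \<in> B'. X (s + d) w = z \<and> (\<forall>i\<in>{1..m}. X (s + d + real i * d) w \<noteq> a)}" for z
  have C: "C z \<in> sets (P x)" for z
    unfolding C_def using Suc.prems B' by (intro avoid_event filtration_event) auto
  have "{w \<in> B. X s w = y \<and> (\<forall>i\<in>{1..Suc m}. X (s + real i * d) w \<noteq> a)} = (\<Union>z\<in>-{a}. C z)"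
  proof -
    have *: "(\<forall>i\<in>{1..Suc m}. Q i) \<longleftrightarrow> Q 1 \<and> (\<forall>i\<in>{1..m}. Q (Suc i))" for Q
    proof safe
      fix i assume "Q 1" "\<forall>i\<in>{1..m}. Q (Suc i)" "i \<in> {1..Suc m}"
      then show "Q i" by (cases i; cases "i = 1") auto
    qed auto
    show ?thesis
      unfolding * C_def B'_def by (auto simp: algebra_simps)
  qed
  then have "emeasure (P x) {w \<in> B. X s w = y \<and> (\<forall>i\<in>{1..Suc m}. X (s + real i * d) w \<noteq> a)}
     = emeasure (P x) (\<Union>z\<in>-{a}. C z)" by simp
  also have "\<dots> = (\<integral>\<^sup>+z. emeasure (P x) (C z) \<partial>count_space (-{a}))"
    by (rule emeasure_UN_countable) (use C in \<open>auto simp: disjoint_family_on_def C_def\<close>)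
  also have "\<dots> = (\<integral>\<^sup>+z. emeasure (P x) (C z) * indicator (-{a}) z \<partial>count_space UNIV)"
    by (simp add: nn_integral_count_space_indicator)
  also have "\<dots> = (\<integral>\<^sup>+z. emeasure (P x) B' * (ennreal (trans_prob P X d y z) *
       (if z = a then 0 else avoid_prob d a m z)) \<partial>count_space UNIV)"
  proof (rule nn_integral_cong)
    fix z
    have "emeasure (P x) (C z) = emeasure (P x) {w \<in> B'. X (s + d) w = z} * avoid_prob d a m z"
      unfolding C_def using Suc.IH[OF B'] Suc.prems by simp
    also have "emeasure (P x) {w \<in> B'. X (s + d) w = z} = emeasure (P x) B' * ennreal (trans_prob P X d y z)"
      using markov_step[OF Suc.prems(2,3,1), of y z]
      by (simp add: emeasure_eq_measure B'_def conj_assoc trans_prob_def flip: ennreal_mult)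
    finally show "emeasure (P x) (C z) * indicator (-{a}) z = emeasure (P x) B' * (ennreal (trans_prob P X d y z) *
       (if z = a then 0 else avoid_prob d a m z))"
      by (simp add: mult.assoc indicator_def)
  qed
  also have "\<dots> = emeasure (P x) B' * avoid_prob d a (Suc m) y"
    by (simp add: nn_integral_cmult)
  finally show ?case by (simp add: B'_def)
qed simp

lemma emeasure_avoid_start:
  assumes "0 \<le> d"
  shows "emeasure (P y) {w \<in> space (P y). \<forall>i\<in>{1..m}. X (real i * d) w \<noteq> a} = avoid_prob d a m y"
proof -
  interpret prob_space "P y" by (rule prob_space_P)
  have "emeasure (P y) {w \<in> space (P y). X 0 w = y} = emeasure (P y) (space (P y))"
    by (rule emeasure_eq_AE) (use start[of y] state_event in auto)
  then have 1: "emeasure (P y) {w \<in> space (P y). X 0 w = y} = 1"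
    by (simp add: emeasure_space_1)
  have sp: "space (P y) \<in> sets (natural_filtration (P y) X 0)"
    using sets.top[of "natural_filtration (P y) X 0"] by simp
  have "emeasure (P y) {w \<in> space (P y). \<forall>i\<in>{1..m}. X (real i * d) w \<noteq> a}
      = emeasure (P y) {w \<in> space (P y). X 0 w = y \<and> (\<forall>i\<in>{1..m}. X (0 + real i * d) w \<noteq> a)}"
  proof (rule emeasure_eq_AE)
    show "{w \<in> space (P y). \<forall>i\<in>{1..m}. X (real i * d) w \<noteq> a} \<in> sets (P y)"
      using assms by (intro sets.sets_Collect_finite_All) (auto intro!: state_event)
  qed (use start[of y] assms avoid_event[of "space (P y)" y 0 d] in auto)
  also have "\<dots> = avoid_prob d a m y"
    using emeasure_avoid[OF sp order_refl assms, of y m a] 1 by simp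
  finally show ?thesis .
qed

section \<open>Hitting events in continuous time\<close>

definition hits :: "'e \<Rightarrow> real \<Rightarrow> 'w set" where
  "hits a T = {w. \<exists>t\<ge>T. X t w = a}"

text \<open>Mesh and horizon are refined together, so one index gives an increasing sequence with
  union \<open>hits a T\<close> on the sample space. Indices start at 1 to make the complement an
  avoidance event; a hit at time \<open>T\<close> itself is still caught, by
  right-continuity.\<close>

definition grid_hits :: "'e \<Rightarrow> real \<Rightarrow> nat \<Rightarrow> 'w set" where
  "grid_hits a T k = {w. \<exists>i\<in>{1..k * 2 ^ k}. X (T + grid k i) w = a}"

lemma grid_hits_event: "0 \<le> T \<Longrightarrow> space (P x) \<inter> grid_hits a T k \<in> sets (P x)"
proof -
  assume "0 \<le> T"
  then have "{w \<in> space (P x). \<exists>i\<in>{1..k * 2 ^ k}. X (T + grid k i) w = a} \<in> sets (P x)"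
    by (intro sets.sets_Collect_finite_Ex) (auto intro!: state_event)
  then show ?thesis by (simp add: grid_hits_def Int_def)
qed

lemma incseq_grid_hits: "incseq (grid_hits a T)"
proof (rule incseq_SucI, rule subsetI)
  fix k w
  assume "w \<in> grid_hits a T k"
  then obtain i where "i \<in> {1..k * 2 ^ k}" "X (T + grid k i) w = a"
    by (auto simp: grid_hits_def)
  moreover have "grid k i = grid (Suc k) (i * 2)"
    using grid_refine[of k "Suc k" i] by simp
  ultimately show "w \<in> grid_hits a T (Suc k)"
    unfolding grid_hits_def by (intro CollectI bexI[of _ "i * 2"]) auto
qed

lemma UN_grid_hits:
  assumes "0 \<le> T"
  shows "space (P x) \<inter> hits a T = (\<Union>k. space (P x) \<inter> grid_hits a T k)"
proof (intro set_eqI iffI)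
  fix w assume "w \<in> space (P x) \<inter> hits a T"
  then obtain t where w: "w \<in> space (P x)" "T \<le> t" "X t w = a" by (auto simp: hits_def)
  obtain k i where ki: "X (T + grid k i) w = a" "1 \<le> i"
    using cadlag_dyadic[OF cadlag_X[OF w(1)] assms w(2)] w(3) by metis
  \<comment> \<open>The level must be at least \<open>k\<close> to contain the grid point and at
    least \<open>i\<close> for the refined index to stay below the horizon
    \<open>l * 2 ^ l\<close>.\<close>
  define l where "l = max k i"
  have "grid k i = grid l (i * 2 ^ (l - k))"
    by (rule grid_refine) (simp add: l_def)
  moreover have "i * 2 ^ (l - k) \<le> l * 2 ^ l"
    by (intro mult_mono power_increasing) (auto simp: l_def)
  ultimately have "w \<in> grid_hits a T l"
    using ki by (auto simp: grid_hits_def intro!: bexI[of _ "i * 2 ^ (l - k)"])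
  with w show "w \<in> (\<Union>k. space (P x) \<inter> grid_hits a T k)" by auto
next
  fix w assume "w \<in> (\<Union>k. space (P x) \<inter> grid_hits a T k)"
  then obtain k i where "w \<in> space (P x)" "X (T + grid k i) w = a"
    by (auto simp: grid_hits_def)
  then show "w \<in> space (P x) \<inter> hits a T"
    by (auto simp: hits_def intro!: exI[of _ "T + grid k i"])
qed

lemma hits_event:
  assumes "0 \<le> T"
  shows "space (P x) \<inter> hits a T \<in> sets (P x)"
  unfolding UN_grid_hits[OF assms] by (intro sets.countable_UN image_subsetI grid_hits_event assms)

definition hit_prob :: "'e \<Rightarrow> 'e \<Rightarrow> real" where
  "hit_prob a x = measure (P x) (space (P x) \<inter> hits a 0)"

text \<open>Avoidance probabilities factor at time \<open>T\<close>, with the same factor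
  \<open>avoid_prob\<close> as for the process started at \<open>y\<close>; passing to complements
  gives the factorisation for hits.\<close>

lemma measure_grid_hits:
  assumes "0 \<le> T"
  shows "measure (P x) ({w \<in> space (P x). X T w = y} \<inter> grid_hits a T k)
       = trans_prob P X T x y * measure (P y) (space (P y) \<inter> grid_hits a 0 k)"
proof -
  interpret prob_space "P x" by (rule prob_space_P)
  interpret y: prob_space "P y" by (rule prob_space_P)
  let ?d = "1 / 2 ^ k :: real" and ?m = "k * 2 ^ k"
  let ?A = "{w \<in> space (P x). X T w = y}"
  let ?N = "{w \<in> space (P x). X T w = y \<and> (\<forall>i\<in>{1..?m}. X (T + real i * ?d) w \<noteq> a)}"
  let ?N' = "{w \<in> space (P y). \<forall>i\<in>{1..?m}. X (real i * ?d) w \<noteq> a}"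
  have A: "?A \<in> sets (P x)" using assms by (intro state_event)
  have N: "?N \<in> sets (P x)" using assms by (intro avoid_event) auto
  have N': "?N' \<in> sets (P y)"
    by (intro sets.sets_Collect_finite_All) (auto intro!: state_event)
  have sp: "space (P x) \<in> sets (natural_filtration (P x) X T)"
    using sets.top[of "natural_filtration (P x) X T"] by simp
  have "emeasure (P x) ?N = emeasure (P x) ?A * emeasure (P y) ?N'"
    using emeasure_avoid[OF sp assms, of ?d y ?m a] emeasure_avoid_start[of ?d y ?m a] by simp
  then have eq: "prob ?N = prob ?A * y.prob ?N'"
    by (simp add: emeasure_eq_measure y.emeasure_eq_measure flip: ennreal_mult)
  have "?A \<inter> grid_hits a T k = ?A - ?N"
    by (auto simp: grid_hits_def grid_def)
  then have "prob (?A \<inter> grid_hits a T k) = prob ?A - prob ?N"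
    using finite_measure_Diff[OF A N] by force
  moreover have "space (P y) \<inter> grid_hits a 0 k = space (P y) - ?N'"
    by (auto simp: grid_hits_def grid_def)
  then have "y.prob (space (P y) \<inter> grid_hits a 0 k) = 1 - y.prob ?N'"
    using y.prob_compl[OF N'] by simp
  ultimately show ?thesis
    unfolding eq trans_prob_def by (simp only: right_diff_distrib mult_1_right)
qed

text \<open>The Markov property at time \<open>T\<close> for the event of a later hit. Both sides
  are limits of the grid versions as the grid is refined.\<close>

lemma markov_hits:
  assumes "0 \<le> T"
  shows "measure (P x) ({w \<in> space (P x). X T w = y} \<inter> hits a T) = trans_prob P X T x y * hit_prob a y"
proof -
  interpret prob_space "P x" by (rule prob_space_P)
  interpret y: prob_space "P y" by (rule prob_space_P)
  let ?A = "{w \<in> space (P x). X T w = y}"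
  have A: "?A \<inter> grid_hits a T k \<in> sets (P x)" for k
  proof -
    have "?A \<inter> grid_hits a T k = ?A \<inter> (space (P x) \<inter> grid_hits a T k)" by auto
    then show ?thesis using state_event[OF assms, of x] grid_hits_event[OF assms, of x] by auto
  qed
  have "(\<lambda>k. prob (?A \<inter> grid_hits a T k)) \<longlonglongrightarrow> prob (\<Union>k. ?A \<inter> grid_hits a T k)"
    using A incseq_grid_hits[of a T] by (intro finite_Lim_measure_incseq) (auto simp: incseq_def)
  moreover have "(\<Union>k. ?A \<inter> grid_hits a T k) = ?A \<inter> hits a T"
    using UN_grid_hits[OF assms, of x a] by blast
  moreover have "(\<lambda>k. y.prob (space (P y) \<inter> grid_hits a 0 k)) \<longlonglongrightarrow> y.prob (\<Union>k. space (P y) \<inter> grid_hits a 0 k)"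
    using incseq_grid_hits[of a 0] grid_hits_event[of 0 y] by (intro y.finite_Lim_measure_incseq) (auto simp: incseq_def)
  then have "(\<lambda>k. trans_prob P X T x y * y.prob (space (P y) \<inter> grid_hits a 0 k)) \<longlonglongrightarrow> trans_prob P X T x y * hit_prob a y"
    by (intro tendsto_mult_left) (simp add: hit_prob_def UN_grid_hits)
  ultimately show ?thesis
    using measure_grid_hits[OF assms, of x y a] by (simp add: LIMSEQ_unique)
qed

section \<open>Superharmonicity of the hitting probability and its relation to recurrence\<close>

lemma hit_prob_bounds: "0 \<le> hit_prob a x" "hit_prob a x \<le> 1"
  using prob_space.prob_le_1[OF prob_space_P, of x] by (auto simp: hit_prob_def)

lemma hit_prob_self: "hit_prob a a = 1"
proof -
  interpret prob_space "P a" by (rule prob_space_P)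
  have "AE w in P a. w \<in> space (P a) \<inter> hits a 0"
    using start[of a] AE_space by eventually_elim (auto simp: hits_def)
  then show ?thesis
    unfolding hit_prob_def using hits_event[of 0 a a] by (simp add: prob_eq_1)
qed

text \<open>A hit after time \<open>t\<close> is in particular a hit after time 0. Splitting it
  according to the state at time \<open>t\<close>, dividing by \<open>t\<close> and letting
  \<open>t\<close> tend to 0 turns transition probabilities into rates.\<close>

lemma hit_prob_superharmonic:
  assumes "finite F" "x \<notin> F"
  shows "(\<Sum>y\<in>F. r x y * hit_prob a y) \<le> holding_rate r x * hit_prob a x"
proof -
  interpret prob_space "P x" by (rule prob_space_P)
  have bound: "(\<Sum>y\<in>F. trans_prob P X t x y * hit_prob a y) \<le> (1 - trans_prob P X t x x) * hit_prob a x"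
    if "0 \<le> t" for t
  proof -
    define A where "A y = {w \<in> space (P x). X t w = y} \<inter> hits a t" for y
    have A: "A y \<in> sets (P x)" for y
    proof -
      have "A y = {w \<in> space (P x). X t w = y} \<inter> (space (P x) \<inter> hits a t)" by (auto simp: A_def)
      then show ?thesis using state_event[OF that, of x] hits_event[OF that, of x] by auto
    qed
    \<comment> \<open>The state \<open>x\<close> is included so that its term, moved to the right,
      produces the factor \<open>1 - trans_prob P X t x x\<close>, whose derivative is the holding
      rate.\<close>
    have "(\<Sum>y\<in>insert x F. trans_prob P X t x y * hit_prob a y) = (\<Sum>y\<in>insert x F. prob (A y))"
      using markov_hits[OF that, of x _ a] by (simp add: A_def)
    also have "\<dots> = prob (\<Union>y\<in>insert x F. A y)"
      using assms A by (intro finite_measure_finite_Union[symmetric]) (auto simp: disjoint_family_on_def A_def)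
    also have "\<dots> \<le> prob (space (P x) \<inter> hits a 0)"
      using that by (intro finite_measure_mono hits_event) (auto simp: A_def hits_def intro: order_trans)
    finally show ?thesis
      using assms by (simp add: hit_prob_def algebra_simps)
  qed
  show ?thesis
  proof (rule tendsto_le)
    show "((\<lambda>t. \<Sum>y\<in>F. trans_prob P X t x y / t * hit_prob a y) \<longlongrightarrow> (\<Sum>y\<in>F. r x y * hit_prob a y)) (at_right 0)"
      using assms by (intro tendsto_sum tendsto_mult_right jump_rate) auto
    show "((\<lambda>t. (1 - trans_prob P X t x x) / t * hit_prob a x) \<longlongrightarrow> holding_rate r x * hit_prob a x) (at_right 0)"
      by (intro tendsto_mult_right leave_rate)
    show "\<forall>\<^sub>F t in at_right 0. (\<Sum>y\<in>F. trans_prob P X t x y / t * hit_prob a y)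
        \<le> (1 - trans_prob P X t x x) / t * hit_prob a x"
      using eventually_at_right_less[of "0::real"]
    proof eventually_elim
      case (elim t)
      then show ?case
        using bound[of t] by (simp add: divide_right_mono flip: sum_divide_distrib)
    qed
  qed simp
qed

text \<open>At some time \<open>t > 0\<close> the process started at \<open>x\<close> is at
  \<open>y\<close> with positive probability, and it almost surely visits \<open>x\<close> after
  \<open>t\<close>. Hence the visit is certain given the state \<open>y\<close> at time
  \<open>t\<close>.\<close>

lemma recurrent_neighbour_hits:
  assumes "recurrent_process P X" "x \<noteq> y" "0 < r x y"
  shows "hit_prob x y = 1"
proof -
  interpret prob_space "P x" by (rule prob_space_P)
  have "\<forall>\<^sub>F t in at_right 0. 0 < trans_prob P X t x y / t \<and> 0 < t"
    using order_tendstoD(1)[OF jump_rate[OF assms(2)] assms(3)] eventually_at_right_less[of "0::real"]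
    by eventually_elim simp
  from eventually_happens'[OF _ this] obtain t where t: "0 < t" "0 < trans_prob P X t x y"
    by (auto simp: zero_less_divide_iff)
  have meas: "{w \<in> space (P x). X t w = y} \<in> sets (P x)"
    using t by (intro state_event) simp
  have "{w \<in> space (P x). X t w = y} \<inter> hits x t = {w \<in> space (P x). X t w = y} \<inter> (space (P x) \<inter> hits x t)"
    by auto
  then have meas': "{w \<in> space (P x). X t w = y} \<inter> hits x t \<in> sets (P x)"
    using meas hits_event[of t x x] t by auto
  have "AE w in P x. \<forall>T\<ge>0. \<exists>t\<ge>T. X t w = x"
    using assms(1) by (simp add: recurrent_process_def)
  then have "AE w in P x. w \<in> hits x t"
    by eventually_elim (use t in \<open>auto simp: hits_def\<close>)
  then have "prob ({w \<in> space (P x). X t w = y} \<inter> hits x t) = prob {w \<in> space (P x). X t w = y}"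
    by (intro finite_measure_eq_AE meas meas') auto
  then have "trans_prob P X t x y * hit_prob x y = trans_prob P X t x y"
    using markov_hits[of t x y x] t by (simp add: trans_prob_def)
  with t show ?thesis by simp
qed

text \<open>By \<open>markov_hits\<close> a visit to \<open>x\<close> after time \<open>n\<close> is
  almost sure given any state at time \<open>n\<close>; only countably many states and integers
  \<open>n\<close> are involved.\<close>

lemma recurrent_if_hit_prob_1:
  assumes "\<And>a x. hit_prob a x = 1"
  shows "recurrent_process P X"
  unfolding recurrent_process_def
proof
  fix x
  interpret prob_space "P x" by (rule prob_space_P)
  have "AE w in P x. w \<in> hits x (real n)" for n
  proof -
    have "AE w in P x. X (real n) w = y \<longrightarrow> w \<in> hits x (real n)" for y
    proof -
      let ?A = "{w \<in> space (P x). X (real n) w = y}"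
      have A: "?A \<in> sets (P x)" by (intro state_event) simp
      have "?A \<inter> hits x (real n) = ?A \<inter> (space (P x) \<inter> hits x (real n))" by auto
      then have A': "?A \<inter> hits x (real n) \<in> sets (P x)"
        using A hits_event[of "real n" x x] by auto
      have "prob (?A \<inter> hits x (real n)) = prob ?A"
        using markov_hits[of "real n" x y x] assms by (simp add: trans_prob_def)
      then have "prob (?A - (?A \<inter> hits x (real n))) = 0"
        using finite_measure_Diff[OF A A'] by simp
      then have "?A - (?A \<inter> hits x (real n)) \<in> null_sets (P x)"
        using A A' by (auto simp: null_sets_def emeasure_eq_measure)
      then show ?thesis
        by (rule AE_I') auto
    qed
    then have "AE w in P x. \<forall>y. X (real n) w = y \<longrightarrow> w \<in> hits x (real n)"
      by (subst AE_all_countable) blast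
    then show ?thesis by simp
  qed
  then have "AE w in P x. \<forall>n. w \<in> hits x (real n)"
    by (simp add: AE_all_countable)
  then show "AE w in P x. \<forall>T\<ge>0. \<exists>t\<ge>T. X t w = x"
  proof eventually_elim
    case (elim w)
    show ?case
    proof safe
      fix T :: real
      obtain n where "T \<le> real n" using real_arch_simple by blast
      with elim[rule_format, of n] show "\<exists>t\<ge>T. X t w = x"
        by (auto simp: hits_def intro: order_trans)
    qed
  qed
qed

section \<open>Minimality of the hitting probability among superharmonic functions\<close>

definition grid_confined_hits :: "'e \<Rightarrow> 'e set \<Rightarrow> nat \<Rightarrow> nat \<Rightarrow> 'w set" where
  "grid_confined_hits a V k m = {w. \<exists>i\<le>m. X (grid k i) w = a \<and> (\<forall>j\<le>i. X (grid k j) w \<in> V)}"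

lemma grid_confined_hits_event: "space (P x) \<inter> grid_confined_hits a V k m \<in> sets (P x)"
proof -
  have "{w \<in> space (P x). \<exists>i\<in>{..m}. X (grid k i) w = a \<and> (\<forall>j\<in>{..i}. X (grid k j) w \<in> V)} \<in> sets (P x)"
    by (intro sets.sets_Collect_finite_Ex sets.sets_Collect_conj sets.sets_Collect_finite_All state_event) auto
  moreover have "space (P x) \<inter> grid_confined_hits a V k m =
     {w \<in> space (P x). \<exists>i\<in>{..m}. X (grid k i) w = a \<and> (\<forall>j\<in>{..i}. X (grid k j) w \<in> V)}"
    by (auto simp: grid_confined_hits_def)
  ultimately show ?thesis by simp
qed

text \<open>A supermartingale argument for the chain with time step \<open>1 / 2 ^ k\<close>, killed
  outside \<open>V\<close> and stopped at \<open>a\<close>: the expected value of \<open>h\<close>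
  grows by at most \<open>e\<close> per step, and a stopped path contributes at most
  \<open>h a\<close>, which is at least 1.\<close>

lemma grid_confined_bound:
  fixes V :: "'e set"
  assumes V: "finite V" "a \<in> V" "y \<in> V"
    and h: "\<And>x. x \<in> V \<Longrightarrow> 0 \<le> h x" "1 \<le> h a" and e: "0 \<le> e"
    and super: "\<And>x. x \<in> V \<Longrightarrow> x \<noteq> a \<Longrightarrow> (\<Sum>z\<in>V. trans_prob P X (1 / 2 ^ k) x z * h z) \<le> h x + e"
  shows "measure (P y) (space (P y) \<inter> grid_confined_hits a V k m) \<le> h y + real m * e"
proof (cases "y = a")
  case True
  have "measure (P y) (space (P y) \<inter> grid_confined_hits a V k m) \<le> 1"
    by (rule prob_space.prob_le_1[OF prob_space_P])
  also have "1 \<le> h y + real m * e"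
    using True h(2) e by (simp add: add_increasing2)
  finally show ?thesis .
next
  case False
  interpret prob_space "P y" by (rule prob_space_P)
  let ?p = "trans_prob P X (1 / 2 ^ k)"
  let ?U = "V - {a}"
  \<comment> \<open>\<open>B i\<close> collects the paths neither killed nor stopped by step
    \<open>i\<close>. Below, \<open>S i z\<close> sorts them by their present position and
    \<open>T i x z\<close> by their next move.\<close>
  define B where "B i = {w \<in> space (P y). \<forall>j\<in>{..i}. X (grid k j) w \<in> ?U}" for i
  define H where "H i = space (P y) \<inter> grid_confined_hits a V k i" for i
  have B: "B i \<in> sets (natural_filtration (P y) X (grid k i))" for i
  proof -
    have "{w \<in> space (natural_filtration (P y) X (grid k i)). \<forall>j\<in>{..i}. X (grid k j) w \<in> ?U}
        \<in> sets (natural_filtration (P y) X (grid k i))"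
    proof (rule sets.sets_Collect_finite_All)
      fix j assume "j \<in> {..i}"
      then have "grid k j \<le> grid k i" by (simp add: grid_mono)
      then show "{w \<in> space (natural_filtration (P y) X (grid k i)). X (grid k j) w \<in> ?U}
          \<in> sets (natural_filtration (P y) X (grid k i))"
        using state_event_filtration[of "grid k j" "grid k i" "P y" "\<lambda>z. z \<in> ?U"] by simp
    qed simp
    then show ?thesis by (simp add: B_def)
  qed
  have H: "H i \<in> events" for i
    unfolding H_def by (rule grid_confined_hits_event)
  define S where "S i z = {w \<in> B i. X (grid k i) w = z}" for i z
  have S: "S i z \<in> events" for i z
    unfolding S_def by (intro event_state filtration_event[OF B]) simp
  define T where "T i x z = {w \<in> B i. X (grid k i) w = x \<and> X (grid k i + 1 / 2 ^ k) w = z}" for i x z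
  have T_eq: "T i x z = {w \<in> S i x. X (grid k i + 1 / 2 ^ k) w = z}" for i x z
    by (auto simp: T_def S_def)
  have T: "T i x z \<in> events" for i x z
    unfolding T_eq by (intro event_state S) simp
  have prob_T: "prob (T i x z) = prob (S i x) * ?p x z" for i x z
    unfolding T_def S_def using B by (intro markov_step) auto
  have finU: "finite ?U" using V by simp
  \<comment> \<open>The expected value of \<open>h\<close> along the skeleton killed off \<open>V\<close>, with the value 1 after hitting \<open>a\<close>.\<close>
  define \<Phi> where "\<Phi> i = (\<Sum>z\<in>?U. prob (S i z) * h z) + prob (H i)" for i
  have sum_S: "(\<Sum>x\<in>?U. prob (S i x)) \<le> 1" for i
  proof -
    have "(\<Sum>x\<in>?U. prob (S i x)) = prob (\<Union>x\<in>?U. S i x)"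
      using finU S by (intro finite_measure_finite_Union[symmetric]) (auto simp: disjoint_family_on_def S_def)
    then show ?thesis by simp
  qed
  have base: "\<Phi> 0 \<le> h y"
  proof -
    have AE0: "AE w in P y. X 0 w = y" by (rule start)
    have "prob (S 0 z) = 0" if "z \<noteq> y" for z
      using AE0 that S[of 0 z] by (subst measure_eq_AE[of _ "{}"]) (auto simp: S_def elim: eventually_mono)
    then have "(\<Sum>z\<in>?U. prob (S 0 z) * h z) = (\<Sum>z\<in>{y}. prob (S 0 z) * h z)"
      using finU V False by (intro sum.mono_neutral_right) auto
    also have "\<dots> \<le> 1 * h y"
      using h(1) V by (simp add: mult_left_le_one_le)
    finally have "(\<Sum>z\<in>?U. prob (S 0 z) * h z) \<le> h y" by simp
    moreover have "AE w in P y. w \<in> H 0 \<longleftrightarrow> w \<in> {}"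
      using AE0 by eventually_elim (use False in \<open>auto simp: H_def grid_confined_hits_def\<close>)
    then have "prob (H 0) = prob {}"
      using H[of 0] by (rule measure_eq_AE) simp
    then have "prob (H 0) = 0" by simp
    ultimately show ?thesis by (simp add: \<Phi>_def)
  qed
  have step: "\<Phi> (Suc i) \<le> \<Phi> i + e" for i
  proof -
    have Bs: "w \<in> B (Suc i) \<longleftrightarrow> w \<in> B i \<and> X (grid k i + 1 / 2 ^ k) w \<in> ?U" for w
      by (auto simp: B_def atMost_Suc grid_Suc)
    have "prob (S (Suc i) z) = (\<Sum>x\<in>?U. prob (S i x) * ?p x z)" if "z \<in> ?U" for z
    proof -
      have "S (Suc i) z = (\<Union>x\<in>?U. T i x z)"
      proof (intro set_eqI iffI)
        fix w assume "w \<in> S (Suc i) z"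
        then have w: "w \<in> B i" "X (grid k i + 1 / 2 ^ k) w = z"
          by (auto simp: S_def Bs grid_Suc)
        moreover from w have "X (grid k i) w \<in> ?U"
          unfolding B_def by blast
        ultimately show "w \<in> (\<Union>x\<in>?U. T i x z)"
          unfolding T_def by blast
      qed (use that in \<open>auto simp: S_def T_def Bs grid_Suc\<close>)
      then have "prob (S (Suc i) z) = (\<Sum>x\<in>?U. prob (T i x z))"
        using finU T by (auto intro!: finite_measure_finite_Union simp: disjoint_family_on_def T_def)
      then show ?thesis by (simp add: prob_T)
    qed
    then have 1: "(\<Sum>z\<in>?U. prob (S (Suc i) z) * h z) = (\<Sum>x\<in>?U. prob (S i x) * (\<Sum>z\<in>?U. ?p x z * h z))"
      by (simp add: sum_distrib_right sum_distrib_left mult.assoc) (rule sum.swap)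
    \<comment> \<open>A hit that is new at step \<open>i + 1\<close> is a move to \<open>a\<close>
      by a path still alive at step \<open>i\<close>.\<close>
    have "H (Suc i) \<subseteq> H i \<union> (\<Union>x\<in>?U. T i x a)"
    proof
      fix w assume "w \<in> H (Suc i)"
      then obtain l where w: "w \<in> space (P y)" "l \<le> Suc i" "X (grid k l) w = a" "\<forall>j\<le>l. X (grid k j) w \<in> V"
        by (auto simp: H_def grid_confined_hits_def)
      show "w \<in> H i \<union> (\<Union>x\<in>?U. T i x a)"
      proof (cases "w \<in> H i")
        case False
        then have l: "l = Suc i"
          using w by (auto simp: H_def grid_confined_hits_def le_Suc_eq)
        have "X (grid k j) w \<noteq> a" if "j \<le> i" for j
          using False w that l by (auto simp: H_def grid_confined_hits_def)
        then have "w \<in> B i"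
          using w l by (auto simp: B_def)
        moreover from this have "X (grid k i) w \<in> ?U"
          unfolding B_def by blast
        ultimately have "w \<in> T i (X (grid k i) w) a" "X (grid k i) w \<in> ?U"
          using w(3) l by (simp_all add: T_def grid_Suc)
        then show ?thesis by (rule UnI2[OF UN_I, rotated])
      qed simp
    qed
    then have "prob (H (Suc i)) \<le> prob (H i \<union> (\<Union>x\<in>?U. T i x a))"
      using H T finU by (intro finite_measure_mono sets.Un sets.finite_UN) auto
    also have "\<dots> \<le> prob (H i) + prob (\<Union>x\<in>?U. T i x a)"
      using H T finU by (intro measure_Un_le sets.finite_UN) auto
    also have "prob (\<Union>x\<in>?U. T i x a) \<le> (\<Sum>x\<in>?U. prob (T i x a))"
      using T finU by (intro finite_measure_subadditive_finite) auto
    finally have 2: "prob (H (Suc i)) \<le> prob (H i) + (\<Sum>x\<in>?U. prob (S i x) * ?p x a)"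
      by (simp add: prob_T)
    have p_nonneg: "0 \<le> ?p x z" for x z by (simp add: trans_prob_def)
    have "\<Phi> (Suc i) \<le> prob (H i) + (\<Sum>x\<in>?U. prob (S i x) * ((\<Sum>z\<in>?U. ?p x z * h z) + ?p x a))"
      unfolding \<Phi>_def 1 using 2 by (simp add: distrib_left sum.distrib)
    also have "\<dots> \<le> prob (H i) + (\<Sum>x\<in>?U. prob (S i x) * (h x + e))"
    proof (intro add_left_mono sum_mono mult_left_mono)
      fix x assume x: "x \<in> ?U"
      \<comment> \<open>The weight 1 of a new hit is at most \<open>h a\<close>, which completes the
        sum over \<open>V\<close> in the hypothesis on \<open>h\<close>.\<close>
      have "(\<Sum>z\<in>?U. ?p x z * h z) + ?p x a \<le> (\<Sum>z\<in>?U. ?p x z * h z) + ?p x a * h a"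
        using mult_left_mono[OF h(2) p_nonneg[of x a]] by simp
      also have "\<dots> = (\<Sum>z\<in>V. ?p x z * h z)"
        using V by (simp add: sum.remove[of V a])
      also have "\<dots> \<le> h x + e" using super x by simp
      finally show "(\<Sum>z\<in>?U. ?p x z * h z) + ?p x a \<le> h x + e" .
    qed simp
    also have "\<dots> = \<Phi> i + (\<Sum>x\<in>?U. prob (S i x)) * e"
      by (simp add: \<Phi>_def distrib_left sum.distrib sum_distrib_right)
    also have "\<dots> \<le> \<Phi> i + 1 * e"
      using sum_S e by (intro add_left_mono mult_right_mono)
    finally show ?thesis by simp
  qed
  have "\<Phi> m \<le> h y + real m * e"
  proof (induction m)
    case (Suc m) then show ?case using step[of m] by (simp add: algebra_simps)
  qed (use base in simp)
  moreover have "prob (H m) \<le> \<Phi> m"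
    unfolding \<Phi>_def using h(1) by (auto intro!: sum_nonneg)
  ultimately show ?thesis by (simp add: H_def)
qed

text \<open>Confinement is demanded at dyadic times of every level up to the hit, not only of level
  \<open>N\<close>. This makes the events increase with \<open>N\<close> along an exhaustion and
  places them inside \<open>grid_confined_hits\<close> at every finer level.\<close>

definition confined_hits :: "'e \<Rightarrow> 'e set \<Rightarrow> nat \<Rightarrow> 'w set" where
  "confined_hits a V N =
     {w. \<exists>i\<le>N * 2 ^ N. X (grid N i) w = a \<and> (\<forall>k j. grid k j \<le> grid N i \<longrightarrow> X (grid k j) w \<in> V)}"

lemma confined_hits_event: "space (P x) \<inter> confined_hits a V N \<in> sets (P x)"
proof -
  have "{w \<in> space (P x). \<exists>i\<in>{..N * 2 ^ N}. X (grid N i) w = a \<and>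
      (\<forall>k j. grid k j \<le> grid N i \<longrightarrow> X (grid k j) w \<in> V)} \<in> sets (P x)"
    by (intro sets.sets_Collect_finite_Ex sets.sets_Collect state_event) auto
  moreover have "space (P x) \<inter> confined_hits a V N = {w \<in> space (P x). \<exists>i\<in>{..N * 2 ^ N}. X (grid N i) w = a \<and>
      (\<forall>k j. grid k j \<le> grid N i \<longrightarrow> X (grid k j) w \<in> V)}"
    by (auto simp: confined_hits_def)
  ultimately show ?thesis by simp
qed

text \<open>Superharmonicity for the rates makes \<open>h\<close> almost superharmonic for the
  transition probabilities over a short time \<open>t\<close>, with error \<open>e' * t\<close>. On
  the finite set \<open>V\<close> this is uniform, and the errors over a fixed time horizon add up
  to at most \<open>e\<close>.\<close>

lemma confined_hits_le_superharmonic: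
  fixes V :: "'e set"
  assumes V: "finite V" "a \<in> V" "y \<in> V"
    and h: "\<And>x. x \<in> V \<Longrightarrow> 0 \<le> h x" "1 \<le> h a"
    and super: "\<And>x. x \<in> V \<Longrightarrow> x \<noteq> a \<Longrightarrow> (\<Sum>z\<in>V - {x}. r x z * h z) \<le> holding_rate r x * h x"
  shows "measure (P y) (space (P y) \<inter> confined_hits a V N) \<le> h y"
proof (rule field_le_epsilon)
  fix e :: real assume "0 < e"
  interpret prob_space "P y" by (rule prob_space_P)
  \<comment> \<open>The grid of mesh \<open>1 / 2 ^ k\<close> takes \<open>N * 2 ^ k\<close> steps
    to the horizon \<open>N\<close>, so the total error is \<open>N * e'\<close>; the added 1 covers
    \<open>N = 0\<close>.\<close>
  define e' where "e' = e / (real N + 1)"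
  have e': "0 < e'" "real N * e' \<le> e" using \<open>0 < e\<close> by (simp_all add: e'_def field_simps)
  have "\<forall>\<^sub>F t in at_right 0. (\<Sum>z\<in>V. trans_prob P X t x z * h z) \<le> h x + e' * t"
    if x: "x \<in> V" "x \<noteq> a" for x
  proof -
    have "((\<lambda>t. (\<Sum>z\<in>V - {x}. trans_prob P X t x z / t * h z) - (1 - trans_prob P X t x x) / t * h x)
        \<longlongrightarrow> (\<Sum>z\<in>V - {x}. r x z * h z) - holding_rate r x * h x) (at_right 0)"
      by (intro tendsto_diff tendsto_sum tendsto_mult_right jump_rate leave_rate) auto
    then have "\<forall>\<^sub>F t in at_right 0. (\<Sum>z\<in>V - {x}. trans_prob P X t x z / t * h z) - (1 - trans_prob P X t x x) / t * h x < e'"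
      by (rule order_tendstoD(2)) (use super[OF x] e' in linarith)
    then show ?thesis
      using eventually_at_right_less[of "0::real"]
    proof eventually_elim
      case (elim t)
      then have "((\<Sum>z\<in>V - {x}. trans_prob P X t x z / t * h z) - (1 - trans_prob P X t x x) / t * h x) * t \<le> e' * t"
        by (intro mult_right_mono) auto
      also have "((\<Sum>z\<in>V - {x}. trans_prob P X t x z / t * h z) - (1 - trans_prob P X t x x) / t * h x) * t
         = (\<Sum>z\<in>V - {x}. trans_prob P X t x z * h z) - (1 - trans_prob P X t x x) * h x"
        using elim by (simp add: left_diff_distrib[of _ _ t] sum_distrib_right)
      finally show ?case
        using V x by (simp add: sum.remove[of V x] algebra_simps)
    qed
  qed
  then have "\<forall>\<^sub>F t in at_right 0. \<forall>x\<in>V - {a}. (\<Sum>z\<in>V. trans_prob P X t x z * h z) \<le> h x + e' * t"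
    using V by (simp add: eventually_ball_finite_distrib)
  then have "\<forall>\<^sub>F k in sequentially. \<forall>x\<in>V - {a}.
      (\<Sum>z\<in>V. trans_prob P X (1 / 2 ^ k) x z * h z) \<le> h x + e' * (1 / 2 ^ k)"
    using filterlim_dyadic_at_right_0 by (rule eventually_compose_filterlim)
  then have "\<forall>\<^sub>F k in sequentially. N \<le> k \<and> (\<forall>x\<in>V - {a}.
      (\<Sum>z\<in>V. trans_prob P X (1 / 2 ^ k) x z * h z) \<le> h x + e' * (1 / 2 ^ k))"
    using eventually_ge_at_top[of N] by eventually_elim simp
  then obtain k where k: "N \<le> k" "\<And>x. x \<in> V - {a} \<Longrightarrow>
      (\<Sum>z\<in>V. trans_prob P X (1 / 2 ^ k) x z * h z) \<le> h x + e' * (1 / 2 ^ k)"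
    by (auto dest!: eventually_happens'[OF sequentially_bot])
  have "confined_hits a V N \<subseteq> grid_confined_hits a V k (N * 2 ^ k)"
  proof
    fix w assume "w \<in> confined_hits a V N"
    then obtain i where i: "i \<le> N * 2 ^ N" "X (grid N i) w = a"
        "\<And>k j. grid k j \<le> grid N i \<Longrightarrow> X (grid k j) w \<in> V"
      by (auto simp: confined_hits_def)
    define i' where "i' = i * 2 ^ (k - N)"
    have g: "grid N i = grid k i'" unfolding i'_def using k(1) by (rule grid_refine)
    have "i' \<le> N * 2 ^ N * 2 ^ (k - N)"
      unfolding i'_def using i(1) by (rule mult_right_mono) simp
    also have "\<dots> = N * 2 ^ k" using k(1) by (simp flip: power_add)
    finally show "w \<in> grid_confined_hits a V k (N * 2 ^ k)"
      unfolding grid_confined_hits_def using i(2,3) g grid_mono[of _ i' k] by auto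
  qed
  then have "prob (space (P y) \<inter> confined_hits a V N) \<le> prob (space (P y) \<inter> grid_confined_hits a V k (N * 2 ^ k))"
    by (intro finite_measure_mono grid_confined_hits_event) auto
  also have "\<dots> \<le> h y + real (N * 2 ^ k) * (e' * (1 / 2 ^ k))"
    using V h e' k(2) by (intro grid_confined_bound) auto
  also have "\<dots> \<le> h y + e" using e' by simp
  finally show "prob (space (P y) \<inter> confined_hits a V N) \<le> h y + e" .
qed

lemma confined_hits_tendsto:
  "(\<lambda>N. measure (P y) (space (P y) \<inter> confined_hits a (exhaustion a N) N)) \<longlonglongrightarrow> hit_prob a y"
proof -
  interpret prob_space "P y" by (rule prob_space_P)
  have mono: "confined_hits a (exhaustion a M) M \<subseteq> confined_hits a (exhaustion a N) N" if "M \<le> N" for M N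
  proof
    fix w assume "w \<in> confined_hits a (exhaustion a M) M"
    then obtain i where i: "i \<le> M * 2 ^ M" "X (grid M i) w = a"
        "\<And>k j. grid k j \<le> grid M i \<Longrightarrow> X (grid k j) w \<in> exhaustion a M"
      by (auto simp: confined_hits_def)
    have g: "grid M i = grid N (i * 2 ^ (N - M))" using that by (rule grid_refine)
    have "i * 2 ^ (N - M) \<le> M * 2 ^ M * 2 ^ (N - M)"
      using i(1) by (rule mult_right_mono) simp
    also have "\<dots> = M * 2 ^ N" using that by (simp flip: power_add)
    also have "\<dots> \<le> N * 2 ^ N" using that by simp
    finally show "w \<in> confined_hits a (exhaustion a N) N"
      unfolding confined_hits_def using i(2,3) g incseqD[OF incseq_exhaustion that, of a]
      by (intro CollectI exI[of _ "i * 2 ^ (N - M)"]) auto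
  qed
  have "(\<lambda>N. prob (space (P y) \<inter> confined_hits a (exhaustion a N) N))
      \<longlonglongrightarrow> prob (\<Union>N. space (P y) \<inter> confined_hits a (exhaustion a N) N)"
    using mono confined_hits_event[of y] by (intro finite_Lim_measure_incseq) (auto simp: incseq_def)
  also have "(\<Union>N. space (P y) \<inter> confined_hits a (exhaustion a N) N) = space (P y) \<inter> hits a 0"
  proof (intro set_eqI iffI)
    fix w assume "w \<in> (\<Union>N. space (P y) \<inter> confined_hits a (exhaustion a N) N)"
    then obtain N i where "w \<in> space (P y)" "X (grid N i) w = a"
      by (auto simp: confined_hits_def)
    then show "w \<in> space (P y) \<inter> hits a 0"
      by (auto simp: hits_def intro!: exI[of _ "grid N i"])
  next
    fix w assume w: "w \<in> space (P y) \<inter> hits a 0"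
    then have cadlag: "cadlag (\<lambda>t. X t w)" using cadlag_X by auto
    from w obtain t where t: "0 \<le> t" "X t w = a" by (auto simp: hits_def)
    obtain k i where ki: "X (grid k i) w = a"
      using cadlag_dyadic[OF cadlag order_refl t(1)] t(2) by (metis add_0)
    \<comment> \<open>Up to the hit the path visits finitely many states, hence it stays in one set
      of the exhaustion.\<close>
    have "finite ((\<lambda>t. X t w) ` {0..grid k i})"
      using cadlag by (rule cadlag_finite_range)
    then have "\<forall>\<^sub>F N in sequentially. \<forall>z\<in>(\<lambda>t. X t w) ` {0..grid k i}. z \<in> exhaustion a N"
      by (intro eventually_ball_finite) (simp_all add: eventually_in_exhaustion)
    then obtain M where M: "(\<lambda>t. X t w) ` {0..grid k i} \<subseteq> exhaustion a M"
      by (auto dest!: eventually_happens'[OF sequentially_bot])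
    define N where "N = max M (max k i)"
    have g: "grid k i = grid N (i * 2 ^ (N - k))"
      by (rule grid_refine) (simp add: N_def)
    have "i * 2 ^ (N - k) \<le> N * 2 ^ N"
      by (intro mult_mono power_increasing) (auto simp: N_def)
    moreover have "exhaustion a M \<subseteq> exhaustion a N" by (rule incseqD[OF incseq_exhaustion]) (simp add: N_def)
    ultimately have "w \<in> confined_hits a (exhaustion a N) N"
      unfolding confined_hits_def using ki g M
      by (intro CollectI exI[of _ "i * 2 ^ (N - k)"]) (auto simp: image_subset_iff)
    with w show "w \<in> (\<Union>N. space (P y) \<inter> confined_hits a (exhaustion a N) N)" by auto
  qed
  finally show ?thesis by (simp add: hit_prob_def)
qed

text \<open>The bound holds for hits confined to each finite set of the exhaustion and passes to the
  limit. Superharmonicity is asked only away from \<open>a\<close>.\<close>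

lemma hit_prob_le_superharmonic:
  assumes h: "\<And>x. 0 \<le> h x" "1 \<le> h a"
    and super: "\<And>F x. finite F \<Longrightarrow> x \<notin> F \<Longrightarrow> x \<noteq> a \<Longrightarrow> (\<Sum>z\<in>F. r x z * h z) \<le> holding_rate r x * h x"
  shows "hit_prob a y \<le> h y"
proof (rule tendsto_upperbound[OF confined_hits_tendsto])
  show "\<forall>\<^sub>F N in sequentially. measure (P y) (space (P y) \<inter> confined_hits a (exhaustion a N) N) \<le> h y"
    using eventually_in_exhaustion[of y a]
  proof eventually_elim
    case (elim N)
    show ?case
      using finite_exhaustion[of a N] exhaustion_self[of a N] elim h
      by (rule confined_hits_le_superharmonic) (rule super, simp_all add: finite_exhaustion)
  qed
qed simp

end

subsection \<open>Energy estimates\<close>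

lemma has_sum_diff_real:
  fixes f g :: "'a \<Rightarrow> real"
  assumes "(f has_sum s) A" "(g has_sum t) A"
  shows "((\<lambda>x. f x - g x) has_sum (s - t)) A"
  using has_sum_add[OF assms(1) has_sum_cmult_right[OF assms(2), of "-1"]] by simp

text \<open>Sums run over all pairs of distinct states rather than over the edges: the domain does
  not depend on the rates and is made of the rows \<open>-{x}\<close>.\<close>

definition offdiag :: "('e \<times> 'e) set" where
  "offdiag = {(x, y). x \<noteq> y}"

text \<open>With finitely many nonzero rows, row sums combine into a double sum without any
  interchange of infinite sums.\<close>

lemma has_sum_finite_rows:
  fixes g :: "'e \<Rightarrow> 'e \<Rightarrow> real"
  assumes "finite V" "\<And>x. x \<in> V \<Longrightarrow> (g x has_sum s x) (-{x})"
    and zero: "\<And>x y. x \<notin> V \<Longrightarrow> g x y = 0"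
  shows "((\<lambda>(x, y). g x y) has_sum (\<Sum>x\<in>V. s x)) offdiag"
proof -
  have "((\<lambda>(x, y). g x y) has_sum (\<Sum>x\<in>V. s x)) (\<Union>x\<in>V. Pair x ` (-{x}))"
    using assms(1,2)
  proof (induction V)
    case (insert x V)
    have "((\<lambda>(x, y). g x y) has_sum s x) (Pair x ` (-{x}))"
      using insert.prems[of x] by (subst has_sum_reindex) (auto simp: inj_on_def o_def)
    moreover have "((\<lambda>(x, y). g x y) has_sum (\<Sum>x\<in>V. s x)) (\<Union>x\<in>V. Pair x ` (-{x}))"
      using insert by auto
    ultimately have "((\<lambda>(x, y). g x y) has_sum (s x + (\<Sum>x\<in>V. s x)))
        (Pair x ` (-{x}) \<union> (\<Union>x\<in>V. Pair x ` (-{x})))"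
      using insert.hyps by (intro has_sum_Un_disjoint) auto
    then show ?case using insert.hyps by simp
  qed simp
  moreover have "((\<lambda>(x, y). g x y) has_sum (\<Sum>x\<in>V. s x)) (\<Union>x\<in>V. Pair x ` (-{x})) \<longleftrightarrow>
      ((\<lambda>(x, y). g x y) has_sum (\<Sum>x\<in>V. s x)) offdiag"
    by (rule has_sum_cong_neutral) (auto simp: offdiag_def zero)
  ultimately show ?thesis by simp
qed

lemma has_sum_offdiag_swap:
  "((\<lambda>(x, y). g y x) has_sum s) offdiag \<longleftrightarrow> ((\<lambda>(x, y). g x y) has_sum s) offdiag"
proof -
  have "bij_betw prod.swap offdiag (offdiag :: ('a \<times> 'a) set)"
    by (rule bij_betwI[of _ _ _ prod.swap]) (auto simp: offdiag_def)
  from has_sum_reindex_bij_betw[OF this, of "\<lambda>(x, y). g x y" s] show ?thesis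
    by (simp add: case_prod_unfold)
qed

text \<open>Applied with \<open>p\<close>, \<open>q\<close> the values of the cutoff and
  \<open>a\<close>, \<open>b\<close> those of the subharmonic function at the ends of an edge,
  \<open>k\<close> the symmetric and \<open>j\<close> the antisymmetric conductance. If
  \<open>k = 0\<close> then \<open>j = 0\<close> and both sides vanish.\<close>

lemma caccioppoli_pointwise:
  fixes p q a b k j \<eta> :: real
  assumes "0 \<le> p" "p \<le> 1" "0 \<le> q" "q \<le> 1" "0 \<le> a" "a \<le> 1" "0 \<le> b" "b \<le> 1"
    and "0 \<le> k" "\<bar>j\<bar> \<le> k" "0 < \<eta>"
  shows "k * ((p\<^sup>2 + q\<^sup>2) * (a - b)\<^sup>2 / 4) - (2 + 1 / \<eta>) * (k * (p - q)\<^sup>2) - \<eta> * (j\<^sup>2 / k)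
    \<le> k * ((p\<^sup>2 * a - q\<^sup>2 * b) * (a - b)) - j * (a * b) * (p\<^sup>2 - q\<^sup>2)"
proof (cases "k = 0")
  case True
  then show ?thesis using assms by simp
next
  case False
  then have k: "0 < k" using assms by simp
  have "(a + b)\<^sup>2 \<le> 2\<^sup>2"
    using assms by (intro power_mono) auto
  then have "(a + b)\<^sup>2 * (p - q)\<^sup>2 \<le> 4 * (p - q)\<^sup>2"
    by (intro mult_right_mono) auto
  \<comment> \<open>Completing the square: the only negative term on the right is at least
    \<open>- 2 * (p - q)^2\<close>, because \<open>a + b\<close> is at most 2.\<close>
  moreover have "(p\<^sup>2 * a - q\<^sup>2 * b) * (a - b) - (p\<^sup>2 + q\<^sup>2) * (a - b)\<^sup>2 / 4
     = ((p + q) * (a - b) + 2 * (a + b) * (p - q))\<^sup>2 / 8 - (a + b)\<^sup>2 * (p - q)\<^sup>2 / 2 + ((p - q) * (a - b))\<^sup>2 / 8"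
    by (simp add: power2_eq_square field_simps)
  ultimately have "(p\<^sup>2 + q\<^sup>2) * (a - b)\<^sup>2 / 4 - 2 * (p - q)\<^sup>2 \<le> (p\<^sup>2 * a - q\<^sup>2 * b) * (a - b)"
    using zero_le_power2[of "(p + q) * (a - b) + 2 * (a + b) * (p - q)"] zero_le_power2[of "(p - q) * (a - b)"]
    by linarith
  then have 1: "k * ((p\<^sup>2 + q\<^sup>2) * (a - b)\<^sup>2 / 4 - 2 * (p - q)\<^sup>2) \<le> k * ((p\<^sup>2 * a - q\<^sup>2 * b) * (a - b))"
    using assms by (intro mult_left_mono) auto
  have "j * (a * b) * (p\<^sup>2 - q\<^sup>2) \<le> \<bar>j * (a * b) * (p\<^sup>2 - q\<^sup>2)\<bar>" by simp
  also have "\<dots> = (a * b * (p + q)) * (\<bar>j\<bar> * \<bar>p - q\<bar>)"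
    using assms by (simp add: power2_eq_square square_diff_square_factored abs_mult)
  also have "a * b * (p + q) \<le> 1 * 1 * 2"
    using assms by (intro mult_mono) auto
  then have "(a * b * (p + q)) * (\<bar>j\<bar> * \<bar>p - q\<bar>) \<le> 1 * 1 * 2 * (\<bar>j\<bar> * \<bar>p - q\<bar>)"
    by (intro mult_right_mono) auto
  also have "\<dots> \<le> \<eta> * (j\<^sup>2 / k) + (1 / \<eta>) * (k * (p - q)\<^sup>2)"
  proof -
    \<comment> \<open>Young's inequality with weight \<eta>, which later splits the cross term
      between the sum of \<open>ca^2 / cs\<close> and the energy.\<close>
    have "0 \<le> (\<eta> * \<bar>j\<bar> - k * \<bar>p - q\<bar>)\<^sup>2 / (\<eta> * k)"
      using k assms by simp
    also have "\<dots> = \<eta> * (\<bar>j\<bar>\<^sup>2 / k) + (1 / \<eta>) * (k * \<bar>p - q\<bar>\<^sup>2) - 2 * (\<bar>j\<bar> * \<bar>p - q\<bar>)"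
      using k assms(11) by (simp add: power2_diff field_simps power2_eq_square)
    finally show ?thesis by simp
  qed
  finally show ?thesis using 1 by (simp add: algebra_simps)
qed

section \<open>Conductances, energy and superharmonic functions\<close>

locale stationary_rates =
  fixes r :: "'e::countable \<Rightarrow> 'e \<Rightarrow> real" and \<mu> :: "'e \<Rightarrow> real"
  assumes rate_nonneg: "x \<noteq> y \<Longrightarrow> 0 \<le> r x y"
    and rate_summable: "r x summable_on (-{x})"
    and stationary: "stationary_measure r \<mu>"
begin

abbreviation "c \<equiv> cond \<mu> r"
abbreviation "cs \<equiv> cond_sym \<mu> r"
abbreviation "ca \<equiv> cond_asym \<mu> r"

definition out_cond :: "'e \<Rightarrow> real" where
  "out_cond x = \<mu> x * holding_rate r x"

lemma mu_pos: "0 < \<mu> x"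
  using stationary by (simp add: stationary_measure_def)

lemma c_nonneg: "x \<noteq> y \<Longrightarrow> 0 \<le> c x y"
  using mu_pos[of x] rate_nonneg[of x y] by (simp add: cond_def)

lemma cs_nonneg: "x \<noteq> y \<Longrightarrow> 0 \<le> cs x y"
  using c_nonneg[of x y] c_nonneg[of y x] by (simp add: cond_sym_def)

lemma abs_ca_le: "x \<noteq> y \<Longrightarrow> \<bar>ca x y\<bar> \<le> cs x y"
  using c_nonneg[of x y] c_nonneg[of y x] by (simp add: cond_sym_def cond_asym_def abs_if field_simps)

lemma cs_commute: "cs x y = cs y x"
  by (simp add: cond_sym_def add.commute)

lemma c_has_sum: "(c x has_sum out_cond x) (-{x})"
proof -
  have "((\<lambda>y. r x y) has_sum holding_rate r x) (-{x})"
    unfolding holding_rate_def using rate_summable by (rule has_sum_infsum)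
  then show ?thesis
    unfolding cond_def out_cond_def by (rule has_sum_cmult_right)
qed

text \<open>By stationarity the incoming conductances at \<open>x\<close> have the same sum as the
  outgoing ones, so their average does too. Equivalently, the rows of \<open>ca\<close> sum to
  0.\<close>

lemma cs_has_sum: "(cs x has_sum out_cond x) (-{x})"
proof -
  have "((\<lambda>y. c y x) has_sum out_cond x) (-{x})"
    using stationary by (simp add: stationary_measure_def cond_def out_cond_def)
  from has_sum_cmult_right[OF has_sum_add[OF c_has_sum this], of "1/2"]
  show ?thesis by (simp add: cond_sym_def[abs_def])
qed

lemma holding_rate_sym: "\<mu> x * holding_rate (sym_rate \<mu> r) x = out_cond x"
proof -
  have "((\<lambda>y. cs x y / \<mu> x) has_sum out_cond x / \<mu> x) (-{x})"
    using has_sum_cmult_right[OF cs_has_sum, of "inverse (\<mu> x)"] by (simp add: field_simps)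
  then show ?thesis
    unfolding holding_rate_def sym_rate_def using mu_pos[of x] by (simp add: infsumI)
qed

text \<open>Discrete summation by parts: expand the square. Finite support of \<open>f\<close>
  leaves finitely many nonzero rows, after a swap of the coordinates for the term in
  \<open>f y\<close>. The factor 2 appears because each edge is counted in both directions.\<close>

lemma energy_has_sum:
  assumes V: "finite V" and f: "\<And>x. x \<notin> V \<Longrightarrow> f x = 0"
  shows "((\<lambda>(x, y). cs x y * (f x - f y)\<^sup>2) has_sum
     2 * (\<Sum>x\<in>V. f x * (out_cond x * f x - (\<Sum>y\<in>V - {x}. cs x y * f y)))) offdiag"
proof -
  have 1: "((\<lambda>(x, y). cs x y * (f x)\<^sup>2) has_sum (\<Sum>x\<in>V. out_cond x * (f x)\<^sup>2)) offdiag"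
    using V f by (intro has_sum_finite_rows has_sum_cmult_left cs_has_sum) auto
  then have 2: "((\<lambda>(x, y). cs y x * (f y)\<^sup>2) has_sum (\<Sum>x\<in>V. out_cond x * (f x)\<^sup>2)) offdiag"
    by (subst has_sum_offdiag_swap)
  have "((\<lambda>y. f x * (cs x y * f y)) has_sum f x * (\<Sum>y\<in>V - {x}. cs x y * f y)) (-{x})" for x
    using V f by (intro has_sum_cmult_right has_sum_finite_neutralI) auto
  then have 3: "((\<lambda>(x, y). f x * (cs x y * f y)) has_sum (\<Sum>x\<in>V. f x * (\<Sum>y\<in>V - {x}. cs x y * f y))) offdiag"
    using V f by (intro has_sum_finite_rows) auto
  have "(\<Sum>x\<in>V. out_cond x * (f x)\<^sup>2) + (\<Sum>x\<in>V. out_cond x * (f x)\<^sup>2)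
        + (-2) * (\<Sum>x\<in>V. f x * (\<Sum>y\<in>V - {x}. cs x y * f y))
      = 2 * (\<Sum>x\<in>V. f x * (out_cond x * f x - (\<Sum>y\<in>V - {x}. cs x y * f y)))"
    by (simp add: right_diff_distrib sum_subtractf power2_eq_square mult.left_commute)
  moreover have "(case z of (x, y) \<Rightarrow> cs x y * (f x)\<^sup>2) + (case z of (x, y) \<Rightarrow> cs y x * (f y)\<^sup>2)
      + (-2) * (case z of (x, y) \<Rightarrow> f x * (cs x y * f y)) = (case z of (x, y) \<Rightarrow> cs x y * (f x - f y)\<^sup>2)" for z
  proof (cases z)
    case (Pair x y)
    then show ?thesis
      using cs_commute[of y x] by (simp add: algebra_simps power2_eq_square)
  qed
  ultimately show ?thesis
    using has_sum_add[OF has_sum_add[OF 1 2] has_sum_cmult_right[OF 3, of "-2"]] by (simp only:)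
qed

lemma superharmonic_gradient_bound:
  assumes V: "finite V" and f: "\<And>x. x \<notin> V \<Longrightarrow> f x = 0" "\<And>x. 0 \<le> f x" "\<And>x. f x \<le> 1"
    and u: "\<And>x. 0 \<le> u x" "\<And>x. u x \<le> 1"
    and super: "\<And>F x. finite F \<Longrightarrow> x \<notin> F \<Longrightarrow> (\<Sum>y\<in>F. r x y * u y) \<le> holding_rate r x * u x"
    and E: "((\<lambda>(x, y). cs x y * (f x - f y)\<^sup>2) has_sum e) offdiag"
    and C: "((\<lambda>(x, y). (ca x y)\<^sup>2 / cs x y) has_sum C) offdiag"
    and ab: "a \<noteq> b" "f a = 1" and \<eta>: "0 < \<eta>"
  shows "cs a b * (u a - u b)\<^sup>2 / 4 \<le> (2 + 1 / \<eta>) * e + \<eta> * C"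
proof -
  define v where "v x = 1 - u x" for x
  have v: "0 \<le> v x" "v x \<le> 1" for x using u by (simp_all add: v_def)
  \<comment> \<open>The subharmonicity of \<open>v\<close> multiplied by \<open>f^2 * v\<close>.
    Since \<open>c x\<close> and \<open>cs x\<close> have equal row sums, \<open>cs\<close> can
    replace \<open>c\<close> in the diagonal term; then in \<open>S x y + S y x\<close> the
    antisymmetric part carries only the difference of \<open>f^2\<close>.\<close>
  define S where "S x y = (f x)\<^sup>2 * v x * (cs x y * v x - c x y * v y)" for x y
  have row: "\<exists>s\<le>0. (S x has_sum s) (-{x})" for x
  proof -
    have sm: "(\<lambda>y. c x y * u y) summable_on (-{x})"
    proof (rule summable_on_comparison_test)
      show "c x summable_on (-{x})" using c_has_sum by (rule has_sum_imp_summable)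
    qed (use c_nonneg u in \<open>auto intro: mult_left_le\<close>)
    define s where "s = infsum (\<lambda>y. c x y * u y) (-{x})"
    have "s \<le> out_cond x * u x"
      unfolding s_def
    proof (rule infsum_le_finite_sums[OF sm])
      fix F assume F: "finite F" "F \<subseteq> - {x}"
      have "(\<Sum>y\<in>F. c x y * u y) = \<mu> x * (\<Sum>y\<in>F. r x y * u y)"
        by (simp add: cond_def sum_distrib_left mult.assoc)
      also have "\<dots> \<le> \<mu> x * (holding_rate r x * u x)"
        using F mu_pos[of x] by (intro mult_left_mono super) auto
      finally show "(\<Sum>y\<in>F. c x y * u y) \<le> out_cond x * u x"
        by (simp add: out_cond_def mult.assoc)
    qed
    have "((\<lambda>y. c x y - c x y * u y) has_sum out_cond x - s) (-{x})"
      using c_has_sum has_sum_infsum[OF sm] unfolding s_def by (rule has_sum_diff_real)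
    then have "((\<lambda>y. c x y * v y) has_sum out_cond x - s) (-{x})"
      by (simp add: v_def right_diff_distrib)
    from has_sum_cmult_right[OF has_sum_diff_real[OF has_sum_cmult_left[OF cs_has_sum] this]]
    have "(S x has_sum (f x)\<^sup>2 * v x * (out_cond x * v x - (out_cond x - s))) (-{x})"
      unfolding S_def[abs_def] .
    moreover have "(f x)\<^sup>2 * v x * (out_cond x * v x - (out_cond x - s)) \<le> 0"
    proof (rule mult_nonneg_nonpos)
      show "out_cond x * v x - (out_cond x - s) \<le> 0"
        using \<open>s \<le> out_cond x * u x\<close> by (simp add: v_def right_diff_distrib)
    qed (use v in simp)
    ultimately show ?thesis by blast
  qed
  then obtain s where s: "\<And>x. s x \<le> 0" "\<And>x. (S x has_sum s x) (-{x})"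
    by metis
  have sumS: "((\<lambda>(x, y). S x y) has_sum (\<Sum>x\<in>V. s x)) offdiag"
    using V s(2) by (rule has_sum_finite_rows) (simp add: S_def f)
  then have sumS': "((\<lambda>(x, y). S y x) has_sum (\<Sum>x\<in>V. s x)) offdiag"
    by (subst has_sum_offdiag_swap)
  have T: "((\<lambda>(x, y). S x y + S y x) has_sum ((\<Sum>x\<in>V. s x) + (\<Sum>x\<in>V. s x))) offdiag"
    using has_sum_add[OF sumS sumS'] by (simp add: case_prod_unfold)
  \<comment> \<open>Of the nonnegative gradient terms only that of the edge from \<open>a\<close> to
    \<open>b\<close> is kept, where \<open>f a = 1\<close> bounds the cutoff weight below by
    1.\<close>
  define I where "I z = (if z = (a, b) then cs a b * (u a - u b)\<^sup>2 / 4 else 0)" for z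
  have "(I has_sum (cs a b * (u a - u b)\<^sup>2 / 4)) offdiag"
    using ab by (intro has_sum_finite_neutralI[of "{(a, b)}"]) (auto simp: I_def offdiag_def)
  from has_sum_diff_real[OF has_sum_diff_real[OF this has_sum_cmult_right[OF E, of "2 + 1 / \<eta>"]] has_sum_cmult_right[OF C, of \<eta>]]
  have "cs a b * (u a - u b)\<^sup>2 / 4 - (2 + 1 / \<eta>) * e - \<eta> * C \<le> (\<Sum>x\<in>V. s x) + (\<Sum>x\<in>V. s x)"
  proof (rule has_sum_mono[OF _ T])
    fix z :: "'e \<times> 'e" assume z: "z \<in> offdiag"
    obtain x y where xy: "z = (x, y)" by (cases z)
    then have "x \<noteq> y" using z by (simp add: offdiag_def)
    have "I z \<le> cs x y * (((f x)\<^sup>2 + (f y)\<^sup>2) * (v x - v y)\<^sup>2 / 4)"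
    proof (cases "z = (a, b)")
      case True
      have "1 * (v a - v b)\<^sup>2 \<le> ((f a)\<^sup>2 + (f b)\<^sup>2) * (v a - v b)\<^sup>2"
        using ab by (intro mult_right_mono) auto
      moreover have "(v a - v b)\<^sup>2 = (u a - u b)\<^sup>2"
        by (simp add: v_def power2_commute)
      ultimately show ?thesis
        using True xy cs_nonneg[OF ab(1)] by (auto simp: I_def intro!: mult_left_mono)
    next
      case False
      then show ?thesis using cs_nonneg[OF \<open>x \<noteq> y\<close>] by (simp add: I_def)
    qed
    moreover have "cs x y * (((f x)\<^sup>2 + (f y)\<^sup>2) * (v x - v y)\<^sup>2 / 4) - (2 + 1 / \<eta>) * (cs x y * (f x - f y)\<^sup>2)
        - \<eta> * ((ca x y)\<^sup>2 / cs x y)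
      \<le> cs x y * (((f x)\<^sup>2 * v x - (f y)\<^sup>2 * v y) * (v x - v y)) - ca x y * (v x * v y) * ((f x)\<^sup>2 - (f y)\<^sup>2)"
      using f v cs_nonneg abs_ca_le \<eta> \<open>x \<noteq> y\<close> by (intro caccioppoli_pointwise) auto
    moreover have "S x y + S y x
      = cs x y * (((f x)\<^sup>2 * v x - (f y)\<^sup>2 * v y) * (v x - v y)) - ca x y * (v x * v y) * ((f x)\<^sup>2 - (f y)\<^sup>2)"
      by (simp add: S_def cond_sym_def cond_asym_def field_simps power2_eq_square)
    ultimately show "I z - (2 + 1 / \<eta>) * (case z of (x, y) \<Rightarrow> cs x y * (f x - f y)\<^sup>2)
        - \<eta> * (case z of (x, y) \<Rightarrow> (ca x y)\<^sup>2 / cs x y) \<le> (case z of (x, y) \<Rightarrow> S x y + S y x)"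
      unfolding xy by simp
  qed
  moreover have "(\<Sum>x\<in>V. s x) \<le> 0" using s(1) by (intro sum_nonpos) auto
  ultimately show ?thesis by linarith
qed

text \<open>Solves the Dirichlet problem with value 1 at \<open>a\<close> and 0 outside
  \<open>V\<close> by iterating the averaging operator. The conductances from \<open>x\<close> into
  \<open>V\<close> sum to at most \<open>out_cond x\<close>, so the iterates stay below 1.\<close>

lemma equilibrium_potential:
  assumes V: "finite V" "a \<in> V"
  obtains f where "f a = 1" "\<And>x. 0 \<le> f x" "\<And>x. f x \<le> 1" "\<And>x. x \<notin> V \<Longrightarrow> f x = 0"
    "\<And>x. x \<in> V \<Longrightarrow> x \<noteq> a \<Longrightarrow> out_cond x * f x = (\<Sum>z\<in>V - {x}. cs x z * f z)"
proof -
  define F where "F g x = (if x = a then 1 else if x \<in> V then (\<Sum>z\<in>V - {x}. cs x z * g z) / out_cond x else 0)"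
    for g x
  have partial: "(\<Sum>z\<in>V - {x}. cs x z) \<le> out_cond x" for x
    using V cs_nonneg by (intro has_sum_mono_neutral[OF has_sum_finite cs_has_sum]) auto
  have nonneg: "0 \<le> out_cond x" for x
    using cs_nonneg[of x] by (intro has_sum_nonneg[OF cs_has_sum]) auto
  have F_mono: "F g x \<le> F h x" if "\<And>x. g x \<le> h x" for g h x
  proof (cases "x \<noteq> a \<and> x \<in> V")
    case True
    have "(\<Sum>z\<in>V - {x}. cs x z * g z) \<le> (\<Sum>z\<in>V - {x}. cs x z * h z)"
      by (intro sum_mono mult_left_mono that cs_nonneg) auto
    then show ?thesis using True nonneg by (simp add: F_def divide_right_mono)
  qed (auto simp: F_def)
  have F_le_1: "F g x \<le> 1" if "\<And>x. g x \<le> 1" for g x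
  proof -
    have "(\<Sum>z\<in>V - {x}. cs x z * g z) \<le> (\<Sum>z\<in>V - {x}. cs x z)"
      by (intro sum_mono mult_left_le that cs_nonneg) auto
    then have "(\<Sum>z\<in>V - {x}. cs x z * g z) \<le> out_cond x" using partial by (rule order_trans)
    then show ?thesis using nonneg[of x] by (auto simp: F_def divide_le_eq_1)
  qed
  \<comment> \<open>The least fixed point of \<open>F\<close> is reached monotonically from 0.\<close>
  define g where "g n = (F ^^ n) (\<lambda>_. 0)" for n
  have g_Suc: "g (Suc n) = F (g n)" for n by (simp add: g_def)
  have g_step: "g n x \<le> g (Suc n) x" for n x
  proof (induction n arbitrary: x)
    case 0
    show ?case using cs_nonneg nonneg by (simp add: g_def F_def)
  next
    case (Suc n)
    then show ?case using F_mono[of "g n" "g (Suc n)" x] by (simp add: g_Suc)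
  qed
  have g_le: "g n x \<le> 1" for n x
    by (induction n arbitrary: x) (simp_all add: g_Suc F_le_1, simp add: g_def)
  have g_nonneg: "0 \<le> g n x" for n x
    using incseq_SucI[of "\<lambda>n. g n x"] g_step[of _ x] incseqD[of "\<lambda>n. g n x" 0 n] by (simp add: g_def)
  have "\<exists>l. (\<lambda>n. g n x) \<longlonglongrightarrow> l" for x
    using incseq_convergent[of "\<lambda>n. g n x" 1] incseq_SucI[of "\<lambda>n. g n x"] g_step g_le by metis
  then obtain f where f: "\<And>x. (\<lambda>n. g n x) \<longlonglongrightarrow> f x" by metis
  have "f x = F f x" for x
  proof (rule LIMSEQ_unique)
    show "(\<lambda>n. g (Suc n) x) \<longlonglongrightarrow> f x" using f[of x] by (rule LIMSEQ_Suc)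
    show "(\<lambda>n. g (Suc n) x) \<longlonglongrightarrow> F f x"
      unfolding g_Suc F_def by (cases "out_cond x = 0") (auto intro!: tendsto_intros f)
  qed
  note fix_f = this
  show ?thesis
  proof (rule that)
    show "f a = 1" by (subst fix_f) (simp add: F_def)
    show "0 \<le> f x" "f x \<le> 1" for x
      using LIMSEQ_le_const[OF f[of x], of 0] LIMSEQ_le_const2[OF f[of x], of 1] by (simp_all add: g_nonneg g_le)
    show "f x = 0" if "x \<notin> V" for x
      using that V by (subst fix_f) (auto simp: F_def)
    show "out_cond x * f x = (\<Sum>z\<in>V - {x}. cs x z * f z)" if x: "x \<in> V" "x \<noteq> a" for x
    proof (cases "out_cond x = 0")
      \<comment> \<open>At a state without outgoing conductance the conductances into
        \<open>V\<close> vanish as well, and the equation reads 0 = 0.\<close>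
      case True
      then have "(\<Sum>z\<in>V - {x}. cs x z) = 0"
        using partial[of x] cs_nonneg by (intro antisym sum_nonneg) auto
      then have "\<forall>z\<in>V - {x}. cs x z = 0"
        using V cs_nonneg by (subst (asm) sum_nonneg_eq_0_iff) auto
      with True show ?thesis by simp
    next
      case False
      then show ?thesis using x by (subst fix_f) (simp add: F_def)
    qed
  qed
qed

text \<open>For the equilibrium potential, summation by parts leaves only the term at
  \<open>a\<close>, the energy being twice the flow out of \<open>a\<close>. The potential dominates
  the probability of reaching \<open>a\<close> inside \<open>V N\<close>, which tends to 1 at the
  neighbours of \<open>a\<close> by recurrence, so the flow tends to 0.\<close>

lemma recurrent_small_energy:
  fixes a :: 'e
  assumes "markov_jump_process Ps Xs (sym_rate \<mu> r)" "recurrent_process Ps Xs" "0 < \<epsilon>"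
  obtains V f e where "finite V" "f a = 1" "\<And>x. 0 \<le> f x" "\<And>x. f x \<le> 1" "\<And>x. x \<notin> V \<Longrightarrow> f x = 0"
    "((\<lambda>(x, y). cs x y * (f x - f y)\<^sup>2) has_sum e) offdiag" "e < \<epsilon>"
proof -
  interpret S: markov_jump_process Ps Xs "sym_rate \<mu> r" by fact
  define V where "V = exhaustion a"
  have V: "finite (V N)" "a \<in> V N" for N
    by (simp_all add: V_def finite_exhaustion exhaustion_self)
  have V_ev: "\<forall>\<^sub>F N in sequentially. x \<in> V N" for x
    by (simp add: V_def eventually_in_exhaustion)
  have "\<exists>f. f a = 1 \<and> (\<forall>x. 0 \<le> f x \<and> f x \<le> 1 \<and> (x \<notin> V N \<longrightarrow> f x = 0)) \<and>
      (\<forall>x\<in>V N - {a}. out_cond x * f x = (\<Sum>z\<in>V N - {x}. cs x z * f z))" for N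
    using equilibrium_potential[OF V] by (metis DiffE singletonI)
  then obtain f where fa: "\<And>N. f N a = 1" and f: "\<And>N x. 0 \<le> f N x" "\<And>N x. f N x \<le> 1"
      "\<And>N x. x \<notin> V N \<Longrightarrow> f N x = 0"
    and harm: "\<And>N x. x \<in> V N \<Longrightarrow> x \<noteq> a \<Longrightarrow> out_cond x * f N x = (\<Sum>z\<in>V N - {x}. cs x z * f N z)"
    by (metis Diff_iff singletonD)
  have lim: "(\<lambda>N. f N y) \<longlonglongrightarrow> 1" if y: "y \<noteq> a" "0 < cs a y" for y
  proof (rule tendsto_sandwich)
    have "0 < sym_rate \<mu> r a y" using y mu_pos by (simp add: sym_rate_def)
    then have "S.hit_prob a y = 1"
      using assms(2) y by (intro S.recurrent_neighbour_hits) auto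
    then show "(\<lambda>N. measure (Ps y) (space (Ps y) \<inter> S.confined_hits a (V N) N)) \<longlonglongrightarrow> 1"
      using S.confined_hits_tendsto[of y a] by (simp add: V_def)
    show "\<forall>\<^sub>F N in sequentially. measure (Ps y) (space (Ps y) \<inter> S.confined_hits a (V N) N) \<le> f N y"
      using V_ev[of y]
    proof eventually_elim
      case (elim N)
      show ?case
      proof (rule S.confined_hits_le_superharmonic[OF V elim])
        fix x assume x: "x \<in> V N" "x \<noteq> a"
        have "\<mu> x * (\<Sum>z\<in>V N - {x}. sym_rate \<mu> r x z * f N z) = (\<Sum>z\<in>V N - {x}. cs x z * f N z)"
          using mu_pos[of x] by (simp add: sum_distrib_left sym_rate_def)
        also have "\<dots> = \<mu> x * (holding_rate (sym_rate \<mu> r) x * f N x)"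
          using harm[OF x] holding_rate_sym[of x] by (simp add: mult.assoc[symmetric])
        finally show "(\<Sum>z\<in>V N - {x}. sym_rate \<mu> r x z * f N z) \<le> holding_rate (sym_rate \<mu> r) x * f N x"
          using mu_pos[of x] by simp
      qed (use fa f in auto)
    qed
  qed (use f in auto)
  \<comment> \<open>The state \<open>a\<close> may have infinitely many neighbours, and convergence
    of the potentials is only pointwise; so finitely many neighbours carrying almost all of
    \<open>out_cond a\<close> are fixed first.\<close>
  have "\<forall>\<^sub>F F in finite_subsets_at_top (-{a}). out_cond a - \<epsilon> / 2 < sum (cs a) F"
    using cs_has_sum[of a] assms(3) unfolding has_sum_def by (intro order_tendstoD(1)) auto
  then obtain F where F: "finite F" "F \<subseteq> -{a}" "out_cond a - \<epsilon> / 2 < sum (cs a) F"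
    by (auto simp: eventually_finite_subsets_at_top)
  have "(\<lambda>N. cs a y * f N y) \<longlonglongrightarrow> cs a y" if "y \<in> F" for y
  proof (cases "cs a y = 0")
    case False
    moreover have "y \<noteq> a" using that F by auto
    ultimately have "(\<lambda>N. cs a y * f N y) \<longlonglongrightarrow> cs a y * 1"
      using cs_nonneg[of a y] by (intro tendsto_mult_left lim) auto
    then show ?thesis by simp
  qed simp
  then have "(\<lambda>N. \<Sum>y\<in>F. cs a y * f N y) \<longlonglongrightarrow> sum (cs a) F"
    by (intro tendsto_sum)
  then have "\<forall>\<^sub>F N in sequentially. out_cond a - \<epsilon> / 2 < (\<Sum>y\<in>F. cs a y * f N y)"
    using F(3) by (rule order_tendstoD)
  moreover have "\<forall>\<^sub>F N in sequentially. \<forall>y\<in>F. y \<in> V N"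
    using F(1) V_ev by (simp add: eventually_ball_finite)
  ultimately have "\<forall>\<^sub>F N in sequentially. out_cond a - \<epsilon> / 2 < (\<Sum>y\<in>F. cs a y * f N y) \<and> F \<subseteq> V N"
    by eventually_elim auto
  then obtain N where N: "out_cond a - \<epsilon> / 2 < (\<Sum>y\<in>F. cs a y * f N y)" "F \<subseteq> V N"
    by (auto dest!: eventually_happens'[OF sequentially_bot])
  have "(\<Sum>y\<in>F. cs a y * f N y) \<le> (\<Sum>y\<in>V N - {a}. cs a y * f N y)"
    using F N V f cs_nonneg by (intro sum_mono2) auto
  moreover have "(\<Sum>x\<in>V N. f N x * (out_cond x * f N x - (\<Sum>y\<in>V N - {x}. cs x y * f N y)))
     = out_cond a - (\<Sum>y\<in>V N - {a}. cs a y * f N y)"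
    using V[of N] fa harm by (subst sum.remove[of _ a]) auto
  ultimately have "2 * (\<Sum>x\<in>V N. f N x * (out_cond x * f N x - (\<Sum>y\<in>V N - {x}. cs x y * f N y))) < \<epsilon>"
    using N(1) by simp
  with energy_has_sum[OF V(1) f(3)] show ?thesis
    using V fa f by (intro that[of "V N" "f N"]) auto
qed

lemma superharmonic_eq_on_edges:
  assumes "markov_jump_process Ps Xs (sym_rate \<mu> r)" "recurrent_process Ps Xs"
    and "(\<lambda>(x, y). (ca x y)\<^sup>2 / cs x y) summable_on (edges \<mu> r)"
    and u: "\<And>x. 0 \<le> u x" "\<And>x. u x \<le> 1"
    and super: "\<And>F x. finite F \<Longrightarrow> x \<notin> F \<Longrightarrow> (\<Sum>y\<in>F. r x y * u y) \<le> holding_rate r x * u x"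
    and ab: "a \<noteq> b" "0 < cs a b"
  shows "u a = u b"
proof -
  \<comment> \<open>Off the edges \<open>cs\<close> is 0, and the quotient is 0 by the convention on
    division.\<close>
  have "(\<lambda>(x, y). (ca x y)\<^sup>2 / cs x y) summable_on offdiag \<longleftrightarrow>
      (\<lambda>(x, y). (ca x y)\<^sup>2 / cs x y) summable_on (edges \<mu> r)"
  proof (rule summable_on_cong_neutral)
    fix z assume "z \<in> offdiag - edges \<mu> r"
    then show "(case z of (x, y) \<Rightarrow> (ca x y)\<^sup>2 / cs x y) = 0"
      using cs_nonneg by (fastforce simp: offdiag_def edges_def)
  qed (auto simp: offdiag_def edges_def)
  then obtain C where C: "((\<lambda>(x, y). (ca x y)\<^sup>2 / cs x y) has_sum C) offdiag"
    using assms(3) by (auto simp: summable_on_def)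
  have "C \<ge> 0"
    using C by (rule has_sum_nonneg) (auto simp: offdiag_def cs_nonneg)
  have "cs a b * (u a - u b)\<^sup>2 / 4 \<le> 0"
  proof (rule field_le_epsilon)
    fix \<epsilon> :: real assume "0 < \<epsilon>"
    \<comment> \<open>First \<eta> is chosen to make the asymmetric term small, then the energy
      bound \<delta> small against \<open>2 + 1 / \<eta>\<close>. The 1 added to \<open>C\<close>
      covers \<open>C = 0\<close>.\<close>
    define \<eta> where "\<eta> = \<epsilon> / (2 * (C + 1))"
    have \<eta>: "0 < \<eta>" "\<eta> * C \<le> \<epsilon> / 2"
      using \<open>0 < \<epsilon>\<close> \<open>C \<ge> 0\<close> by (simp_all add: \<eta>_def field_simps)
    define \<delta> where "\<delta> = \<epsilon> / (2 * (2 + 1 / \<eta>))"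
    have "0 < 2 + 1 / \<eta>" using \<eta> by (simp add: add_pos_pos)
    then have \<delta>: "0 < \<delta>" "(2 + 1 / \<eta>) * \<delta> = \<epsilon> / 2"
      using \<open>0 < \<epsilon>\<close> by (simp_all add: \<delta>_def del: distrib_left_numeral)
    obtain V f e where f: "finite V" "f a = 1" "\<And>x. 0 \<le> f x" "\<And>x. f x \<le> 1" "\<And>x. x \<notin> V \<Longrightarrow> f x = 0"
        "((\<lambda>(x, y). cs x y * (f x - f y)\<^sup>2) has_sum e) offdiag" "e < \<delta>"
      by (rule recurrent_small_energy[OF assms(1,2) \<delta>(1), of a]) (rule that; assumption)
    have "cs a b * (u a - u b)\<^sup>2 / 4 \<le> (2 + 1 / \<eta>) * e + \<eta> * C"
      using superharmonic_gradient_bound[OF f(1,5,3,4) u super f(6) C ab(1) f(2) \<eta>(1)] .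
    also have "(2 + 1 / \<eta>) * e \<le> (2 + 1 / \<eta>) * \<delta>"
      using f(7) \<open>0 < 2 + 1 / \<eta>\<close> by (intro mult_left_mono) auto
    finally show "cs a b * (u a - u b)\<^sup>2 / 4 \<le> 0 + \<epsilon>" using \<eta> \<delta> by linarith
  qed
  then have "cs a b * (u a - u b)\<^sup>2 \<le> 0" by simp
  then have "(u a - u b)\<^sup>2 \<le> 0" using ab by (simp add: mult_le_0_iff)
  then show ?thesis by simp
qed

end

section \<open>Recurrence of the original process\<close>

theorem lemma5p3:
  fixes r :: "'e::countable \<Rightarrow> 'e \<Rightarrow> real"
    and \<mu> :: "'e \<Rightarrow> real"
    and P :: "'e \<Rightarrow> 'w measure" and X :: "real \<Rightarrow> 'w \<Rightarrow> 'e"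
    and Ps :: "'e \<Rightarrow> 'v measure" and Xs :: "real \<Rightarrow> 'v \<Rightarrow> 'e"
  assumes "markov_jump_process P X r"
    and "irreducible_process P X"
    and "stationary_measure r \<mu>"
    and "markov_jump_process Ps Xs (sym_rate \<mu> r)"
    and "recurrent_process Ps Xs"
    and "(\<lambda>(x, y). (cond_asym \<mu> r x y)\<^sup>2 / cond_sym \<mu> r x y) summable_on (edges \<mu> r)"
  shows "recurrent_process P X"
proof -
  interpret markov_jump_process P X r by fact
  interpret stationary_rates r \<mu>
    by unfold_locales (use rate_nonneg rate_summable assms(3) in auto)
  show ?thesis
  proof (rule recurrent_if_hit_prob_1)
    fix a x :: 'e
    let ?A = "{y. hit_prob a y = 1}"
    show "hit_prob a x = 1"
    proof (rule ccontr)
      assume x: "hit_prob a x \<noteq> 1"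
      \<comment> \<open>A positive rate gives an edge, and across an edge the hitting probability is
        constant; so no jump leads into \<open>?A\<close> from outside.\<close>
      have closed: "r y z = 0" if "y \<notin> ?A" "z \<in> ?A" for y z
      proof (rule ccontr)
        assume "r y z \<noteq> 0"
        moreover have "y \<noteq> z" using that by auto
        ultimately have "0 < cs y z"
          using rate_nonneg[of y z] mu_pos[of y] c_nonneg[of z y]
          by (auto simp: cond_sym_def cond_def intro!: add_pos_nonneg)
        then have "hit_prob a y = hit_prob a z"
          using \<open>y \<noteq> z\<close> hit_prob_bounds hit_prob_superharmonic
          by (intro superharmonic_eq_on_edges[OF assms(4-6)]) auto
        with that show False by simp
      qed
      \<comment> \<open>As \<open>?A\<close> cannot be entered, its indicator is superharmonic, and
        it is 1 at \<open>a\<close>. By minimality the hitting probability vanishes outside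
        \<open>?A\<close>, which contradicts irreducibility.\<close>
      have "hit_prob a x \<le> indicator ?A x"
      proof (rule hit_prob_le_superharmonic)
        fix F :: "'e set" and y
        assume F: "finite F" "y \<notin> F"
        show "(\<Sum>z\<in>F. r y z * indicator ?A z) \<le> holding_rate r y * indicator ?A y"
        proof (cases "y \<in> ?A")
          case True
          have "(\<Sum>z\<in>F. r y z * indicator ?A z) \<le> (\<Sum>z\<in>F. r y z)"
            using F by (intro sum_mono mult_left_le) (auto simp: indicator_def intro!: rate_nonneg)
          also have "\<dots> \<le> holding_rate r y"
            unfolding holding_rate_def
            using F rate_summable by (intro finite_sum_le_infsum) (auto intro!: rate_nonneg)
          finally show ?thesis using True by simp
        next
          case False
          have "(\<Sum>z\<in>F. r y z * indicator ?A z) = 0"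
            using closed[OF False] by (intro sum.neutral) (auto simp: indicator_def)
          with False show ?thesis by simp
        qed
      qed (simp_all add: hit_prob_self)
      then have "hit_prob a x \<le> 0"
        using x by simp
      moreover obtain t where t: "0 \<le> t" "0 < trans_prob P X t x a"
        using assms(2) by (auto simp: irreducible_process_def)
      have "trans_prob P X t x a \<le> hit_prob a x"
        unfolding trans_prob_def hit_prob_def using t
        by (intro finite_measure.finite_measure_mono hits_event prob_space.finite_measure prob_space_P)
          (auto simp: hits_def)
      ultimately show False using t by simp
    qed
  qed
qed

end
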